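(* Let $n\ge 3$. Let $U\subset\mathcal S^{n\times n}$ be an open set such that $M+N\in U$ whenever $M\in U$ and $N\in\mathcal S^{n\times n}_+$, and $aM\in U$ whenever $M\in U$ and $a>0$. Let $\eta\in C^2(B_2\setminus\{0\})\cap C^0(B_2)$ satisfy $\eta(0)=0$, $\eta(x)>0$ for all $x\in B_2\setminus\{0\}$, and $D^2\eta(x)\notin U$ for all $x\in B_2\setminus\{0\}$. Suppose that $u\in C^0_{loc}(B_2\setminus\{0\})$ satisfies $u>0$ in $B_2\setminus\{0\}$ and there exist positive functions $\{u_i\}$ in $C^2(B_2\setminus\{0\})$ with $$\Delta u_i\le 0,\quad A^{u_i}\in\overline U\quad\text{in } B_2\setminus\{0\},\qquad u_i\to u\ \text{ in } C^0_{loc}(B_2\setminus\{0\}).$$ Then $\xi:=u^{-\frac{2}{n-2}}$ can be extended as a function in $C^0(B_1)$ and $$\sup_{B_1\setminus\{0\}}\xi\le\max_{\partial B_1}\xi=\left[\min_{\partial B_1}u\right]^{-\frac{2}{n-2}},$$ $$|\xi(x)-\xi(y)|\le C(\eta)\left[\min_{\partial B_1}u\right]^{-\frac{2}{n-2}}\left[\eta(x-y)+\eta(y-x)\right],\qquad\forall x,y\in B_{1/4},$$ where $C(\eta)$ is some positive constant depending only on $\eta$. Consequently, either $$0<\inf_{B_1\setminus\{0\}}u\le\sup_{B_1\setminus\{0\}}u<\infty\quad\text{and}\quad u\in C^0(B_1)$$ (that is, $u$ extends continuously to $B_1$), or $$\inf_{x\in B_1\setminus\{0\}}\left[\eta(x)+\eta(-x)\right]^{\frac{n-2}{2}}u(x)>0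 .$$
   Context: $\mathcal S^{n\times n}$ is the set of real symmetric $n\times n$ matrices, $\mathcal S^{n\times n}_+$ the subset of positive definite ones, $\overline U$ the closure of $U$. $B_a\subset\mathbb R^n$ is the ball of radius $a$ centered at the origin. $D^2$ denotes the Hessian. $C^0_{loc}$ convergence means uniform convergence on compact subsets. For a positive $C^2$ function $w$, $$A^w=-\frac{2}{n-2}w^{-\frac{n+2}{n-2}}\nabla^2w+\frac{2n}{(n-2)^2}w^{-\frac{2n}{n-2}}\nabla w\otimes\nabla w-\frac{2}{(n-2)^2}w^{-\frac{2n}{n-2}}|\nabla w|^2 I,$$ with $I$ the identity matrix. *)

theory Defs
  imports "HOL-Analysis.Analysis"
begin

definition sym_mats :: "(real^'n^'n) set" where
  "sym_mats = {M. transpose M = M}"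

definition pd_mats :: "(real^'n^'n) set" where
  "pd_mats = {N \<in> sym_mats. \<forall>x. x \<noteq> 0 \<longrightarrow> x \<bullet> (N *v x) > 0}"

definition grad :: "(real^'n \<Rightarrow> real) \<Rightarrow> real^'n \<Rightarrow> real^'n" where
  "grad f x = (\<chi> i. frechet_derivative f (at x) (axis i 1))"

definition hess :: "(real^'n \<Rightarrow> real) \<Rightarrow> real^'n \<Rightarrow> real^'n^'n" where
  "hess f x = jacobian (grad f) (at x)"

definition laplacian :: "(real^'n \<Rightarrow> real) \<Rightarrow> real^'n \<Rightarrow> real" where
  "laplacian f x = trace (hess f x)"

text \<open>Intended for open \<open>S\<close> only: \<open>grad\<close> and \<open>hess\<close> use unrestricted derivatives at the
  points of \<open>S\<close>. Continuity of the gradient follows from its differentiability.\<close>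

definition C2_on :: "(real^'n) set \<Rightarrow> (real^'n \<Rightarrow> real) \<Rightarrow> bool" where
  "C2_on S f \<longleftrightarrow>
     (\<forall>x\<in>S. f differentiable (at x)) \<and>
     (\<forall>x\<in>S. grad f differentiable (at x)) \<and>
     continuous_on S (hess f)"

definition outer :: "real^'n \<Rightarrow> real^'n \<Rightarrow> real^'n^'n" where
  "outer a b = (\<chi> i j. a $ i * b $ j)"

text \<open>The conformal matrix \<open>A\<^sup>w\<close>, meaningful for positive \<open>w\<close> and \<open>n \<ge> 3\<close>.\<close>

definition conf_mat :: "(real^'n \<Rightarrow> real) \<Rightarrow> real^'n \<Rightarrow> real^'n^'n" where
  "conf_mat w x = (let n = real CARD('n) in
     (- (2 / (n - 2)) * w x powr (- ((n + 2) / (n - 2)))) *\<^sub>R hess w x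
     + (2 * n / (n - 2)\<^sup>2 * w x powr (- (2 * n / (n - 2)))) *\<^sub>R outer (grad w x) (grad w x)
     - (2 / (n - 2)\<^sup>2 * w x powr (- (2 * n / (n - 2))) * (norm (grad w x))\<^sup>2) *\<^sub>R mat 1)"

text \<open>Maximum and minimum of a function on a possibly infinite set (\<open>Max\<close> and \<open>Min\<close> are for
  finite sets). They are meaningful when the extremum is attained, for instance for continuous
  \<open>f\<close> and nonempty compact \<open>S\<close>.\<close>

definition max_on :: "'a set \<Rightarrow> ('a \<Rightarrow> real) \<Rightarrow> real" where
  "max_on S f = (GREATEST v. v \<in> f ` S)"

definition min_on :: "'a set \<Rightarrow> ('a \<Rightarrow> real) \<Rightarrow> real" where
  "min_on S f = (LEAST v. v \<in> f ` S)"

end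

theory Submission
  imports Defs
begin

text \<open>
  Write \<open>a = 2 / (n - 2)\<close> and \<open>\<xi> = u powr -a\<close>. The conformal matrix takes the simple form
  \<open>A\<^sup>u = \<xi> D\<^sup>2\<xi> - (1/2) |\<nabla>\<xi>|\<^sup>2 I\<close>. Since \<open>U\<close> is a cone that absorbs positive definite
  matrices, \<open>A\<^sup>u \<in> closure U\<close> makes \<open>\<xi>\<close> a subsolution: \<open>D\<^sup>2\<xi> + M \<in> U\<close> for every positive
  definite \<open>M\<close>. The barrier \<open>\<eta>\<close>, with \<open>D\<^sup>2\<eta> \<notin> U\<close>, is a supersolution, and both properties
  ignore gradients. Hence the function
  \<open>\<xi> - c \<eta>(\<cdot> - y) + e |x|\<^sup>2 + p \<cdot> x\<close> with \<open>c, e > 0\<close> has no local maximum away from the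
  poles \<open>0\<close> and \<open>y\<close> (\<open>no_interior_maximum\<close>), for \<^emph>\<open>every\<close> linear term \<open>p \<cdot> x\<close>.

  The linear term serves to exclude a maximum at the puncture. If \<open>\<xi> - c \<eta>(\<cdot> - y)\<close> exceeds
  \<open>\<xi>(y)\<close> somewhere in the unit ball, then for all small \<open>p\<close> the supremum of the perturbed
  function is reached neither inside the ball nor at \<open>y\<close>, nor on the unit sphere when \<open>c\<close> is
  large; so it is approached only at \<open>0\<close>, where the linear term is invisible. The supremum
  therefore does not depend on \<open>p\<close>. Letting \<open>p\<close> run over a small sphere places the graph of
  \<open>\<xi>\<close> near \<open>0\<close> below a smooth function minus the cone \<open>e |x|\<close>, whose vertex value is the upper
  limit of \<open>\<xi>\<close> at \<open>0\<close>. By convexity of \<open>t powr -(1/a)\<close>, the superharmonic function \<open>u\<close> lies on a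
  small sphere above an affine function whose value at \<open>0\<close> exceeds the lower limit of \<open>u\<close>
  there. The minimum principle in the punctured ball, which holds because
  \<open>- ln |x|\<close> is superharmonic, positive near \<open>0\<close> and infinite at \<open>0\<close>, forbids this
  (\<open>no_conical_upper_contact_at_puncture\<close>).

  This proves \<open>\<xi>(x) - \<xi>(y) \<le> c \<eta>(x - y)\<close> (\<open>comparison_with_translated_barrier\<close>), where
  \<open>c\<close> is the bound \<open>(min u) powr -a\<close> of \<open>\<xi>\<close> over the unit sphere divided by the
  minimum of \<open>\<eta>\<close> over the annulus \<open>3/4 \<le> |z| \<le> 5/4\<close>, to which \<open>x - y\<close> belongs for
  \<open>|x| = 1\<close> and \<open>|y| < 1/4\<close>. The estimate involves no derivatives, so it passes to locally
  uniform limits. As \<open>\<eta>\<close> vanishes at \<open>0\<close>, it yields the continuous extension of \<open>\<xi>\<close>; the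
  final alternative distinguishes whether the extended value \<open>\<xi>(0)\<close> is positive or zero.
\<close>

section \<open>Functions with a second derivative at a point\<close>

text \<open>
  The matrix is kept as an argument instead of being computed by \<^const>\<open>hess\<close>, so that the Hessian
  of a compound function is obtained by composing the rules below. The gradient is a field
  because its derivative at the point needs values nearby.
\<close>

definition has_hess ::
    "(real^'n \<Rightarrow> real) \<Rightarrow> (real^'n \<Rightarrow> real^'n) \<Rightarrow> real^'n^'n \<Rightarrow> real^'n \<Rightarrow> bool" where
  "has_hess f G H x \<longleftrightarrow>
     (\<forall>\<^sub>F z in nhds x. (f has_derivative (\<lambda>h. G z \<bullet> h)) (at z)) \<and>
     (G has_derivative (\<lambda>h. H *v h)) (at x)"

lemma has_derivative_grad:
  assumes "f differentiable (at x)"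
  shows "(f has_derivative (\<lambda>h. grad f x \<bullet> h)) (at x)"
proof -
  have D: "(f has_derivative frechet_derivative f (at x)) (at x)"
    using assms frechet_derivative_works by blast
  then have lin: "linear (frechet_derivative f (at x))"
    by (rule has_derivative_linear)
  have "frechet_derivative f (at x) h = grad f x \<bullet> h" for h
  proof -
    have "frechet_derivative f (at x) h = frechet_derivative f (at x) (\<Sum>i\<in>UNIV. (h $ i) *\<^sub>R axis i 1)"
      using basis_expansion[of h] by (simp add: scalar_mult_eq_scaleR)
    also have "\<dots> = (\<Sum>i\<in>UNIV. h $ i * frechet_derivative f (at x) (axis i 1))"
      by (simp add: linear_sum[OF lin] linear_scale[OF lin])
    finally show ?thesis
      by (simp add: grad_def inner_vec_def mult.commute)
  qed
  then show ?thesis using D by presburger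
qed

lemma C2_on_has_hess:
  assumes "C2_on S f" "open S" "x \<in> S"
  shows "has_hess f (grad f) (hess f x) x"
  unfolding has_hess_def
proof
  show "\<forall>\<^sub>F z in nhds x. (f has_derivative (\<lambda>h. grad f z \<bullet> h)) (at z)"
    using assms has_derivative_grad unfolding C2_on_def eventually_nhds by blast
  have "grad f differentiable (at x)" using assms by (simp add: C2_on_def)
  then show "(grad f has_derivative (\<lambda>h. hess f x *v h)) (at x)"
    unfolding hess_def using jacobian_works by blast
qed

lemma has_hess_add:
  assumes "has_hess f G H x" "has_hess f' G' H' x"
  shows "has_hess (\<lambda>z. f z + f' z) (\<lambda>z. G z + G' z) (H + H') x"
  unfolding has_hess_def
proof
  show "\<forall>\<^sub>F z in nhds x. ((\<lambda>z. f z + f' z) has_derivative (\<lambda>h. (G z + G' z) \<bullet> h)) (at z)"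
    using assms[unfolded has_hess_def, THEN conjunct1]
    by eventually_elim (auto intro!: derivative_eq_intros simp: inner_add_left)
  show "((\<lambda>z. G z + G' z) has_derivative (\<lambda>h. (H + H') *v h)) (at x)"
    using assms unfolding has_hess_def
    by (auto intro!: derivative_eq_intros simp: matrix_vector_mult_add_rdistrib)
qed

lemma has_hess_scale:
  assumes "has_hess f G H x"
  shows "has_hess (\<lambda>z. c * f z) (\<lambda>z. c *\<^sub>R G z) (c *\<^sub>R H) x"
  unfolding has_hess_def
proof
  show "\<forall>\<^sub>F z in nhds x. ((\<lambda>z. c * f z) has_derivative (\<lambda>h. (c *\<^sub>R G z) \<bullet> h)) (at z)"
    using assms[unfolded has_hess_def, THEN conjunct1]
    by eventually_elim (auto intro!: derivative_eq_intros)
  show "((\<lambda>z. c *\<^sub>R G z) has_derivative (\<lambda>h. (c *\<^sub>R H) *v h)) (at x)"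
    using assms unfolding has_hess_def
    by (auto intro!: derivative_eq_intros simp: scaleR_matrix_vector_assoc)
qed

lemma has_hess_affine: "has_hess (\<lambda>z. c + p \<bullet> z) (\<lambda>z. p) 0 x"
proof -
  have "((\<lambda>z. c + p \<bullet> z) has_derivative (\<lambda>h. p \<bullet> h)) (at z)" for z
    by (auto intro!: derivative_eq_intros)
  moreover have "((\<lambda>z. p) has_derivative (\<lambda>h. 0 *v h)) (at x)" by simp
  ultimately show ?thesis by (simp add: has_hess_def)
qed

lemma has_hess_norm_square: "has_hess (\<lambda>z. z \<bullet> z) (\<lambda>z. 2 *\<^sub>R z) (2 *\<^sub>R mat 1) x"
  unfolding has_hess_def
  by (auto intro!: derivative_eq_intros always_eventually
      simp: inner_commute scaleR_matrix_vector_assoc[symmetric])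

lemma has_hess_shift:
  assumes "has_hess f G H (x - y)"
  shows "has_hess (\<lambda>z. f (z - y)) (\<lambda>z. G (z - y)) H x"
  unfolding has_hess_def
proof
  have sh: "((\<lambda>z. z - y) has_derivative (\<lambda>h. h)) (at z)" for z
    by (auto intro!: derivative_eq_intros)
  have "filterlim (\<lambda>z. z - y) (nhds (x - y)) (nhds x)"
    by (intro tendsto_intros filterlim_ident)
  from filterlim_iff[THEN iffD1, OF this] assms
  have "\<forall>\<^sub>F z in nhds x. (f has_derivative (\<lambda>h. G (z - y) \<bullet> h)) (at (z - y))"
    unfolding has_hess_def by blast
  then show "\<forall>\<^sub>F z in nhds x. ((\<lambda>z. f (z - y)) has_derivative (\<lambda>h. G (z - y) \<bullet> h)) (at z)"
    by eventually_elim (use has_derivative_compose[OF sh] in force)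
  show "((\<lambda>z. G (z - y)) has_derivative (\<lambda>h. H *v h)) (at x)"
    using assms has_derivative_compose[OF sh] unfolding has_hess_def by force
qed

lemma outer_vec_mult: "outer a b *v h = (b \<bullet> h) *\<^sub>R a"
  by (simp add: vec_eq_iff outer_def matrix_vector_mult_def inner_vec_def sum_distrib_left
      sum_distrib_right mult_ac)

lemma has_hess_isCont:
  assumes "has_hess f G H x"
  shows "isCont f x"
  using assms eventually_nhds_x_imp_x[of _ x] has_derivative_continuous
  unfolding has_hess_def by blast

lemma has_hess_compose:
  assumes f: "has_hess f G H x"
    and \<phi>: "\<forall>\<^sub>F t in nhds (f x). (\<phi> has_real_derivative \<phi>' t) (at t)"
    and \<phi>': "(\<phi>' has_real_derivative \<phi>'') (at (f x))"
  shows "has_hess (\<lambda>z. \<phi> (f z)) (\<lambda>z. \<phi>' (f z) *\<^sub>R G z)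
           (\<phi>'' *\<^sub>R outer (G x) (G x) + \<phi>' (f x) *\<^sub>R H) x"
  unfolding has_hess_def
proof
  have f1: "\<forall>\<^sub>F z in nhds x. (f has_derivative (\<lambda>h. G z \<bullet> h)) (at z)"
    and G1: "(G has_derivative (\<lambda>h. H *v h)) (at x)"
    using f by (auto simp: has_hess_def)
  have "filterlim f (nhds (f x)) (nhds x)"
    using has_hess_isCont[OF f] by (simp add: isCont_def tendsto_nhds_iff)
  from filterlim_iff[THEN iffD1, OF this] \<phi>
  have "\<forall>\<^sub>F z in nhds x. (\<phi> has_real_derivative \<phi>' (f z)) (at (f z))" by blast
  with f1 show "\<forall>\<^sub>F z in nhds x. ((\<lambda>z. \<phi> (f z)) has_derivative (\<lambda>h. (\<phi>' (f z) *\<^sub>R G z) \<bullet> h)) (at z)"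
  proof eventually_elim
    case (elim z)
    show ?case
      using has_derivative_compose[OF elim(1) elim(2)[unfolded has_field_derivative_def]]
      by simp
  qed
  have fx: "(f has_derivative (\<lambda>h. G x \<bullet> h)) (at x)"
    using f1 eventually_nhds_x_imp_x by blast
  have "((\<lambda>z. \<phi>' (f z)) has_derivative (\<lambda>h. \<phi>'' * (G x \<bullet> h))) (at x)"
    using has_derivative_compose[OF fx \<phi>'[unfolded has_field_derivative_def]] .
  then have "((\<lambda>z. \<phi>' (f z) *\<^sub>R G z) has_derivative
      (\<lambda>h. \<phi>' (f x) *\<^sub>R (H *v h) + (\<phi>'' * (G x \<bullet> h)) *\<^sub>R G x)) (at x)"
    by (rule has_derivative_scaleR[OF _ G1])
  then show "((\<lambda>z. \<phi>' (f z) *\<^sub>R G z) has_derivative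
      (\<lambda>h. (\<phi>'' *\<^sub>R outer (G x) (G x) + \<phi>' (f x) *\<^sub>R H) *v h)) (at x)"
    by (simp add: matrix_vector_mult_add_rdistrib scaleR_matrix_vector_assoc[symmetric]
        outer_vec_mult add.commute)
qed

lemma has_real_derivative_along_line:
  assumes "(f has_derivative (\<lambda>h. G \<bullet> h)) (at (a + t *\<^sub>R v))"
  shows "((\<lambda>t. f (a + t *\<^sub>R v)) has_real_derivative G \<bullet> v) (at t)"
proof -
  have "((\<lambda>t. a + t *\<^sub>R v) has_derivative (\<lambda>h. h *\<^sub>R v)) (at t)"
    by (auto intro!: derivative_eq_intros)
  from has_derivative_compose[OF this assms]
  show ?thesis by (simp add: has_field_derivative_def mult.commute[of _ "G \<bullet> v"])
qed

text \<open>
  Along the line through \<open>x\<close> in direction \<open>v\<close> the first derivative \<open>g\<close> vanishes at \<open>x\<close>. If the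
  second derivative were positive there, \<open>g\<close> would be positive just to the right of \<open>x\<close>, and by
  the mean value theorem the function would exceed its maximum.
\<close>

lemma second_derivative_test_max:
  assumes h: "has_hess f G H x"
    and mx: "\<forall>\<^sub>F z in nhds x. f z \<le> f x"
  shows "v \<bullet> (H *v v) \<le> 0"
proof (rule ccontr)
  assume "\<not> ?thesis"
  then have pos: "v \<bullet> (H *v v) > 0" by simp
  from h have f1: "\<forall>\<^sub>F z in nhds x. (f has_derivative (\<lambda>h. G z \<bullet> h)) (at z)"
    and G1: "(G has_derivative (\<lambda>h. H *v h)) (at x)"
    by (auto simp: has_hess_def)
  have lim: "filterlim (\<lambda>t. x + t *\<^sub>R v) (nhds x) (nhds 0)"
    by (rule tendsto_eq_intros filterlim_ident | simp)+
  have "\<forall>\<^sub>F t in nhds 0. f (x + t *\<^sub>R v) \<le> f x \<and>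
      (f has_derivative (\<lambda>h. G (x + t *\<^sub>R v) \<bullet> h)) (at (x + t *\<^sub>R v))"
    by (rule eventually_compose_filterlim[OF eventually_conj[OF mx f1] lim])
  then obtain d where d: "d > 0"
    and le: "\<And>t. \<bar>t\<bar> < d \<Longrightarrow> f (x + t *\<^sub>R v) \<le> f x"
    and der: "\<And>t. \<bar>t\<bar> < d \<Longrightarrow> (f has_derivative (\<lambda>h. G (x + t *\<^sub>R v) \<bullet> h)) (at (x + t *\<^sub>R v))"
    unfolding eventually_nhds_metric by (auto simp: dist_real_def)
  define g where "g t = G (x + t *\<^sub>R v) \<bullet> v" for t
  have D: "((\<lambda>t. f (x + t *\<^sub>R v)) has_real_derivative g t) (at t)" if "\<bar>t\<bar> < d" for t
    unfolding g_def by (rule has_real_derivative_along_line[OF der[OF that]])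
  have g0: "g 0 = 0"
    by (rule DERIV_local_max[OF D[of 0] d]) (use d le in auto)
  have line: "((\<lambda>t. x + t *\<^sub>R v) has_derivative (\<lambda>h. h *\<^sub>R v)) (at 0)"
    by (auto intro!: derivative_eq_intros)
  have "(G has_derivative (\<lambda>h. H *v h)) (at (x + 0 *\<^sub>R v))" using G1 by simp
  from has_derivative_inner_left[OF has_derivative_compose[OF line this]]
  have "(g has_derivative (\<lambda>h. (H *v (h *\<^sub>R v)) \<bullet> v)) (at 0)"
    unfolding g_def .
  then have "(g has_real_derivative v \<bullet> (H *v v)) (at 0)"
    by (simp add: has_field_derivative_def matrix_vector_mult_scaleR inner_commute
        mult.commute[of _ "v \<bullet> (H *v v)"])
  from DERIV_pos_inc_right[OF this pos] g0
  obtain d' where d': "d' > 0" and gpos: "\<And>t. 0 < t \<Longrightarrow> t < d' \<Longrightarrow> g t > 0" by auto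
  define s where "s = min d d' / 2"
  have s: "0 < s" "s < d" "s < d'" using d d' by (auto simp: s_def)
  obtain z where z: "0 < z" "z < s" and mv: "f (x + s *\<^sub>R v) - f (x + 0 *\<^sub>R v) = (s - 0) * g z"
    using MVT2[of 0 s "\<lambda>t. f (x + t *\<^sub>R v)" g] D s by auto
  have "s * g z > 0" using gpos[of z] z s by simp
  then show False using mv le[of s] s by simp
qed

text \<open>
  The mixed second difference over a parallelogram with sides \<open>s v\<close> and \<open>s w\<close> is, by one
  application of the mean value theorem in direction \<open>v\<close>, \<open>s\<close> times a difference of two gradient
  values. Expanding both around \<open>x\<close> gives \<open>s\<^sup>2 (H w) \<cdot> v\<close> up to an error of order \<open>o(s\<^sup>2)\<close>.
\<close>

lemma second_difference_estimate:
  assumes h: "has_hess f G H x" and e: "e > 0"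
  shows "\<exists>d>0. \<forall>s. 0 < s \<and> s < d \<longrightarrow>
    \<bar>f (x + s *\<^sub>R v + s *\<^sub>R w) - f (x + s *\<^sub>R v) - f (x + s *\<^sub>R w) + f x - s\<^sup>2 * ((H *v w) \<bullet> v)\<bar>
      \<le> e * s\<^sup>2"
proof -
  from h have f1: "\<forall>\<^sub>F z in nhds x. (f has_derivative (\<lambda>h. G z \<bullet> h)) (at z)"
    and G1: "(G has_derivative (\<lambda>h. H *v h)) (at x)"
    by (auto simp: has_hess_def)
  define N where "N = norm v + norm w + 1"
  have N: "N > 0" "norm v + norm w \<le> N" by (auto simp: N_def add_nonneg_pos)
  define e' where "e' = e / (2 * N * N)"
  have e': "e' > 0" using e N by (simp add: e'_def)
  from G1 e' obtain d1 where d1: "d1 > 0"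
    and R: "\<And>z. norm (z - x) < d1 \<Longrightarrow> norm (G z - G x - H *v (z - x)) \<le> e' * norm (z - x)"
    unfolding has_derivative_at_alt by blast
  from f1 obtain d2 where d2: "d2 > 0"
    and der: "\<And>z. norm (z - x) < d2 \<Longrightarrow> (f has_derivative (\<lambda>h. G z \<bullet> h)) (at z)"
    unfolding eventually_nhds_metric by (auto simp: dist_norm)
  define d where "d = min d1 d2 / N"
  have "\<bar>f (x + s *\<^sub>R v + s *\<^sub>R w) - f (x + s *\<^sub>R v) - f (x + s *\<^sub>R w) + f x - s\<^sup>2 * ((H *v w) \<bullet> v)\<bar>
      \<le> e * s\<^sup>2" if s: "0 < s" "s < d" for s
  proof -
    have sN: "s * N < d1" "s * N < d2" using s N by (auto simp: d_def field_simps)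
    have near: "norm (t *\<^sub>R v + r *\<^sub>R w) \<le> s * N" if "0 \<le> t" "t \<le> s" "0 \<le> r" "r \<le> s" for t r
    proof -
      have "norm (t *\<^sub>R v + r *\<^sub>R w) \<le> t * norm v + r * norm w"
        using norm_triangle_ineq[of "t *\<^sub>R v" "r *\<^sub>R w"] that by simp
      also have "\<dots> \<le> s * norm v + s * norm w"
        using that by (intro add_mono mult_right_mono) auto
      also have "\<dots> \<le> s * N" using N s by (simp add: distrib_left[symmetric])
      finally show ?thesis .
    qed
    have shift: "x + s *\<^sub>R w + t *\<^sub>R v - x = t *\<^sub>R v + s *\<^sub>R w" for t by simp
    define g where "g t = G (x + s *\<^sub>R w + t *\<^sub>R v) \<bullet> v - G (x + t *\<^sub>R v) \<bullet> v" for t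
    have D: "((\<lambda>t. f (x + s *\<^sub>R w + t *\<^sub>R v) - f (x + t *\<^sub>R v)) has_real_derivative g t) (at t)"
      if "0 \<le> t" "t \<le> s" for t
      unfolding g_def
    proof (intro DERIV_diff has_real_derivative_along_line der)
      show "norm (x + s *\<^sub>R w + t *\<^sub>R v - x) < d2"
        unfolding shift using near[of t s] that s sN by simp
      show "norm (x + t *\<^sub>R v - x) < d2"
        using near[of t 0] that s sN by simp
    qed
    obtain t where t: "0 < t" "t < s"
      and mv: "(f (x + s *\<^sub>R w + s *\<^sub>R v) - f (x + s *\<^sub>R v)) - (f (x + s *\<^sub>R w) - f x) = s * g t"
      using MVT2[of 0 s "\<lambda>t. f (x + s *\<^sub>R w + t *\<^sub>R v) - f (x + t *\<^sub>R v)" g] D s by auto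
    define A where "A = G (x + s *\<^sub>R w + t *\<^sub>R v) - G x - H *v (t *\<^sub>R v + s *\<^sub>R w)"
    define B where "B = G (x + t *\<^sub>R v) - G x - H *v (t *\<^sub>R v)"
    have A: "norm A \<le> e' * (s * N)"
    proof -
      have "norm A \<le> e' * norm (t *\<^sub>R v + s *\<^sub>R w)"
        unfolding A_def using R[of "x + s *\<^sub>R w + t *\<^sub>R v"] near[of t s] t s sN
        by (simp add: shift)
      also have "\<dots> \<le> e' * (s * N)" using near[of t s] t s e' by (intro mult_left_mono) auto
      finally show ?thesis .
    qed
    have B: "norm B \<le> e' * (s * N)"
    proof -
      have "norm B \<le> e' * norm (t *\<^sub>R v)"
        unfolding B_def using R[of "x + t *\<^sub>R v"] near[of t 0] t s sN by simp
      also have "\<dots> \<le> e' * (s * N)" using near[of t 0] t s e' by (intro mult_left_mono) auto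
      finally show ?thesis .
    qed
    have "g t - s * ((H *v w) \<bullet> v) = (A - B) \<bullet> v"
      by (simp add: g_def A_def B_def inner_diff_left inner_add_left matrix_vector_right_distrib
          matrix_vector_mult_scaleR)
    then have "\<bar>g t - s * ((H *v w) \<bullet> v)\<bar> \<le> norm (A - B) * norm v"
      by (simp add: Cauchy_Schwarz_ineq2)
    also have "\<dots> \<le> (e' * (s * N) + e' * (s * N)) * N"
    proof (intro mult_mono)
      show "norm (A - B) \<le> e' * (s * N) + e' * (s * N)"
        using norm_triangle_ineq4[of A B] A B by linarith
      show "norm v \<le> N" by (simp add: N_def)
    qed (use e' s N in auto)
    also have "\<dots> = e * s" using N by (simp add: e'_def field_simps)
    finally have "s * \<bar>g t - s * ((H *v w) \<bullet> v)\<bar> \<le> s * (e * s)"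
      using s by (intro mult_left_mono) auto
    moreover have "s * \<bar>g t - s * ((H *v w) \<bullet> v)\<bar> = \<bar>s * (g t - s * ((H *v w) \<bullet> v))\<bar>"
      using s by (simp add: abs_mult)
    moreover have "s * (g t - s * ((H *v w) \<bullet> v)) = s * g t - s\<^sup>2 * ((H *v w) \<bullet> v)"
      by (simp add: algebra_simps power2_eq_square)
    moreover have "f (x + s *\<^sub>R v + s *\<^sub>R w) = f (x + s *\<^sub>R w + s *\<^sub>R v)"
      by (simp add: algebra_simps)
    moreover have "s * (e * s) = e * s\<^sup>2"
      by (simp add: power2_eq_square)
    ultimately show ?thesis using mv by linarith
  qed
  moreover have "d > 0" using d1 d2 N by (simp add: d_def)
  ultimately show ?thesis by blast
qed

text \<open>
  The second difference is symmetric in \<open>v\<close> and \<open>w\<close>, hence so is its leading term. This matters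
  because the cone \<open>U\<close> consists of symmetric matrices only: a Hessian outside \<open>U\<close> carries
  information only when it is known to be symmetric.
\<close>

lemma has_hess_symmetric:
  assumes h: "has_hess f G H x"
  shows "transpose H = H"
proof -
  have sym: "(H *v w) \<bullet> v = (H *v v) \<bullet> w" for v w
  proof (rule ccontr)
    assume ne: "\<not> ?thesis"
    define e where "e = \<bar>(H *v w) \<bullet> v - (H *v v) \<bullet> w\<bar> / 3"
    have e: "e > 0" using ne by (simp add: e_def)
    obtain d1 where d1: "d1 > 0" and e1: "\<And>s. 0 < s \<and> s < d1 \<Longrightarrow>
      \<bar>f (x + s *\<^sub>R v + s *\<^sub>R w) - f (x + s *\<^sub>R v) - f (x + s *\<^sub>R w) + f x - s\<^sup>2 * ((H *v w) \<bullet> v)\<bar>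
        \<le> e * s\<^sup>2"
      using second_difference_estimate[OF h e, of v w] by blast
    obtain d2 where d2: "d2 > 0" and e2: "\<And>s. 0 < s \<and> s < d2 \<Longrightarrow>
      \<bar>f (x + s *\<^sub>R w + s *\<^sub>R v) - f (x + s *\<^sub>R w) - f (x + s *\<^sub>R v) + f x - s\<^sup>2 * ((H *v v) \<bullet> w)\<bar>
        \<le> e * s\<^sup>2"
      using second_difference_estimate[OF h e, of w v] by blast
    define s where "s = min d1 d2 / 2"
    have s: "0 < s" "s < d1" "s < d2" using d1 d2 by (auto simp: s_def)
    have sw: "x + s *\<^sub>R w + s *\<^sub>R v = x + s *\<^sub>R v + s *\<^sub>R w" by simp
    have "\<bar>s\<^sup>2 * ((H *v w) \<bullet> v) - s\<^sup>2 * ((H *v v) \<bullet> w)\<bar> \<le> 2 * (e * s\<^sup>2)"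
      using e1[of s] e2[of s] s unfolding sw by linarith
    then have "s\<^sup>2 * \<bar>(H *v w) \<bullet> v - (H *v v) \<bullet> w\<bar> \<le> s\<^sup>2 * (2 * e)"
      unfolding right_diff_distrib[symmetric] abs_mult by (simp add: mult_ac)
    then have "\<bar>(H *v w) \<bullet> v - (H *v v) \<bullet> w\<bar> \<le> 2 * e" using s by simp
    then show False using e by (simp add: e_def)
  qed
  have "H $ i $ j = H $ j $ i" for i j
    using sym[of "axis j 1" "axis i 1"]
    by (simp add: matrix_vector_mul_component inner_axis column_def matrix_vector_mult_basis)
  then show ?thesis by (simp add: vec_eq_iff transpose_def)
qed

section \<open>Sums with matrices in the closure of the cone\<close>

lemma closed_sym_mats: "closed (sym_mats :: (real^'n^'n) set)"
proof -
  have "closed {M :: real^'n^'n. \<forall>i j. M $ i $ j = M $ j $ i}"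
    by (intro closed_Collect_all closed_Collect_eq continuous_intros)
  also have "{M :: real^'n^'n. \<forall>i j. M $ i $ j = M $ j $ i} = sym_mats"
    by (auto simp: sym_mats_def transpose_def vec_eq_iff)
  finally show ?thesis .
qed

lemma inner_matrix_vector_bound:
  fixes E :: "real^'n^'n"
  shows "\<bar>x \<bullet> (E *v x)\<bar> \<le> norm E * (x \<bullet> x)"
proof -
  have "norm (E *v x) \<le> norm (norm x *\<^sub>R E)"
  proof (rule norm_le_componentwise_cart)
    fix i
    show "norm ((E *v x) $ i) \<le> norm ((norm x *\<^sub>R E) $ i)"
      using Cauchy_Schwarz_ineq2[of "E $ i" x]
      by (simp add: matrix_vector_mul_component mult.commute)
  qed
  then have "norm (E *v x) \<le> norm x * norm E" by simp
  then have "norm x * norm (E *v x) \<le> norm x * (norm x * norm E)"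
    by (intro mult_left_mono) auto
  then have "\<bar>x \<bullet> (E *v x)\<bar> \<le> norm x * (norm x * norm E)"
    using Cauchy_Schwarz_ineq2[of x "E *v x"] by linarith
  then show ?thesis unfolding dot_square_norm power2_eq_square by (simp only: mult_ac)
qed

text \<open>
  Approximating \<open>M\<close> by \<open>M' \<in> U\<close>, write \<open>M + N = M' + (N + (M - M'))\<close>. The bracket stays
  positive definite once \<open>M'\<close> is closer to \<open>M\<close> than the ellipticity constant of \<open>N\<close>.
\<close>

lemma closure_add_uniformly_pd:
  fixes U :: "(real^'n^'n) set"
  assumes U: "U \<subseteq> sym_mats" and add: "\<And>M N. M \<in> U \<Longrightarrow> N \<in> pd_mats \<Longrightarrow> M + N \<in> U"
    and M: "M \<in> closure U" and N: "N \<in> sym_mats"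
    and \<kappa>: "\<kappa> > 0" "\<And>x. \<kappa> * (x \<bullet> x) \<le> x \<bullet> (N *v x)"
  shows "M + N \<in> U"
proof -
  obtain M' where M': "M' \<in> U" "dist M' M < \<kappa>"
    using M \<kappa>(1) unfolding closure_approachable by blast
  have Msym: "M \<in> sym_mats" using closure_minimal[OF U closed_sym_mats] M by blast
  have "N + (M - M') \<in> pd_mats"
    unfolding pd_mats_def
  proof (intro CollectI conjI allI impI)
    show "N + (M - M') \<in> sym_mats"
      using N Msym M' U by (fastforce simp: sym_mats_def transpose_def vec_eq_iff)
    fix x :: "real^'n" assume x: "x \<noteq> 0"
    have "norm (M - M') * (x \<bullet> x) < \<kappa> * (x \<bullet> x)"
      using M'(2) x by (intro mult_strict_right_mono) (auto simp: dist_norm norm_minus_commute)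
    then show "0 < x \<bullet> ((N + (M - M')) *v x)"
      using inner_matrix_vector_bound[of x "M - M'"] \<kappa>(2)[of x]
      by (simp add: matrix_vector_mult_add_rdistrib inner_add_right)
  qed
  from add[OF M'(1) this] show ?thesis by (simp add: add.commute)
qed

section \<open>The minimum principle in a punctured ball\<close>

lemma trace_scaleR: "trace (c *\<^sub>R A) = c * trace A"
  by (simp add: trace_def sum_distrib_left)

lemma trace_outer: "trace (outer a b) = a \<bullet> b"
  by (simp add: trace_def outer_def inner_vec_def)

lemma trace_nonpos_at_max:
  assumes "has_hess f G H x" "\<forall>\<^sub>F z in nhds x. f z \<le> f x"
  shows "trace H \<le> 0"
  unfolding trace_def
proof (rule sum_nonpos)
  fix i
  show "H $ i $ i \<le> 0"
    using second_derivative_test_max[OF assms, of "axis i 1"]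
    by (simp add: inner_axis' matrix_vector_mult_basis column_def)
qed

text \<open>
  For \<open>n \<ge> 3\<close> the trace is positive. Thus \<open>- ln (x \<cdot> x)\<close> is strictly superharmonic and tends to
  infinity at \<open>0\<close>: adding a positive multiple of it to a superharmonic function that is bounded
  below keeps minima away from the puncture and makes superharmonicity strict.
\<close>

lemma has_hess_ln_norm_square:
  assumes "x \<noteq> 0"
  shows "\<exists>G H. has_hess (\<lambda>z :: real^'n. ln (z \<bullet> z)) G H x \<and> trace H = 2 * (real CARD('n) - 2) / (x \<bullet> x)"
proof -
  have pos: "x \<bullet> x > 0" using assms by simp
  have "\<forall>\<^sub>F t in nhds (x \<bullet> x). (0::real) < t"
    using pos eventually_nhds_in_open[of "{0<..}" "x \<bullet> x"] by simp
  then have 1: "\<forall>\<^sub>F t in nhds (x \<bullet> x). (ln has_real_derivative inverse t) (at t)"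
    by eventually_elim (auto intro!: derivative_eq_intros simp: divide_inverse)
  have 2: "(inverse has_real_derivative - (inverse (x \<bullet> x) * inverse (x \<bullet> x))) (at (x \<bullet> x))"
    using pos by (auto intro!: derivative_eq_intros)
  have "trace (- (inverse (x \<bullet> x) * inverse (x \<bullet> x)) *\<^sub>R outer (2 *\<^sub>R x) (2 *\<^sub>R x)
      + inverse (x \<bullet> x) *\<^sub>R (2 *\<^sub>R mat 1 :: real^'n^'n)) = 2 * (real CARD('n) - 2) / (x \<bullet> x)"
    using pos by (simp only: trace_add trace_scaleR trace_outer trace_I) (simp add: field_simps)
  with has_hess_compose[OF has_hess_norm_square 1 2] show ?thesis by blast
qed

definition positive_superharmonic :: "(real^'n \<Rightarrow> real) \<Rightarrow> bool" where
  "positive_superharmonic u \<longleftrightarrow> C2_on (ball 0 2 - {0}) u \<and>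
     (\<forall>x \<in> ball 0 2 - {0}. u x > 0 \<and> laplacian u x \<le> 0)"

text \<open>
  An isolated point is negligible for superharmonic functions that are bounded below. The function
  \<open>w\<close> in the proof is the affine function minus \<open>u\<close> minus \<open>e\<close> times the barrier
  \<open>ln (r\<^sup>2) - ln (x \<cdot> x)\<close>. It is negative near \<open>0\<close> by the barrier, nonpositive on the sphere by
  hypothesis, and strictly subharmonic, hence it has no positive maximum in between. Then \<open>e\<close>
  tends to zero.
\<close>

lemma punctured_minimum_principle:
  fixes u :: "real^'n \<Rightarrow> real"
  assumes n: "CARD('n) \<ge> 3" and r: "0 < r" "r < 2"
    and u: "positive_superharmonic u"
    and bd: "\<And>x. norm x = r \<Longrightarrow> c + p \<bullet> x \<le> u x"
    and x0: "x0 \<in> ball 0 r - {0}"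
  shows "c + p \<bullet> x0 \<le> u x0"
proof -
  have C2: "C2_on (ball 0 2 - {0}) u"
    and pos: "\<And>x. x \<in> ball 0 2 - {0} \<Longrightarrow> u x > 0"
    and lap: "\<And>x. x \<in> ball 0 2 - {0} \<Longrightarrow> laplacian u x \<le> 0"
    using u by (auto simp: positive_superharmonic_def)
  have opn: "open (ball 0 2 - {0} :: (real^'n) set)" by (simp add: open_delete)
  have barrier: "c + p \<bullet> x0 - u x0 \<le> e * ln (r\<^sup>2 / (x0 \<bullet> x0))" if e: "e > 0" for e
  proof (rule ccontr)
    assume neg: "\<not> ?thesis"
    define w where "w x = (c - e * ln (r\<^sup>2) + p \<bullet> x) + ((-1) * u x + e * ln (x \<bullet> x))" for x
    have wx0: "w x0 > 0"
      using neg x0 r by (simp add: w_def ln_div algebra_simps)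
    define b where "b = \<bar>c\<bar> + norm p * r"
    \<comment> \<open>the radius at which the barrier term equals the bound \<open>b\<close> of the affine function\<close>
    define \<rho> where "\<rho> = r * exp (- (b / (2 * e)))"
    have b: "b \<ge> 0" using r by (simp add: b_def)
    have \<rho>: "0 < \<rho>" "\<rho> \<le> r" using r b e by (auto simp: \<rho>_def mult_le_cancel_left1)
    have ln\<rho>: "e * ln (\<rho>\<^sup>2) = e * ln (r\<^sup>2) - b"
      using r e by (simp add: \<rho>_def ln_mult ln_realpow field_simps)
    have inner_neg: "w x < 0" if x: "x \<noteq> 0" "norm x \<le> \<rho>" for x
    proof -
      have "x \<bullet> x \<le> \<rho>\<^sup>2" unfolding dot_square_norm using x by (intro power_mono) auto
      then have "e * ln (x \<bullet> x) \<le> e * ln (\<rho>\<^sup>2)" using x e \<rho> by simp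
      moreover have "c + p \<bullet> x \<le> b"
      proof -
        have "p \<bullet> x \<le> norm p * norm x" by (rule norm_cauchy_schwarz)
        also have "\<dots> \<le> norm p * r" using x \<rho> by (intro mult_left_mono) auto
        finally show ?thesis by (simp add: b_def)
      qed
      moreover have "u x > 0" using x \<rho> r by (intro pos) auto
      ultimately show ?thesis using ln\<rho> by (simp add: w_def)
    qed
    have outer_neg: "w x \<le> 0" if "norm x = r" for x
      using bd[OF that] that by (simp add: w_def dot_square_norm del: power2_norm_eq_inner)
    have hess_w: "\<exists>G H. has_hess w G H x \<and> trace H > 0" if x: "x \<in> ball 0 2 - {0}" for x
    proof -
      obtain G H where GH: "has_hess (\<lambda>z :: real^'n. ln (z \<bullet> z)) G H x"
        "trace H = 2 * (real CARD('n) - 2) / (x \<bullet> x)"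
        using has_hess_ln_norm_square x by blast
      have "e * trace H > 0" using GH(2) e n x by simp
      then have "trace (0 + ((-1) *\<^sub>R hess u x + e *\<^sub>R H)) > 0"
        using lap[OF x] by (simp add: trace_add trace_scaleR laplacian_def trace_sub)
      moreover note has_hess_add[OF has_hess_affine has_hess_add[OF
          has_hess_scale[OF C2_on_has_hess[OF C2 opn x]] has_hess_scale[OF GH(1)]],
          of "c - e * ln (r\<^sup>2)" p "-1" e]
      ultimately show ?thesis unfolding w_def[abs_def] by blast
    qed
    define K :: "(real^'n) set" where "K = cball 0 r - ball 0 \<rho>"
    have K: "compact K" unfolding K_def by (simp add: compact_diff)
    have x0K: "x0 \<in> K" using inner_neg[of x0] wx0 x0 by (force simp: K_def)
    have "continuous_on K w"
    proof (intro continuous_at_imp_continuous_on ballI)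
      fix x assume "x \<in> K"
      then have "x \<in> ball 0 2 - {0}" using r \<rho> by (auto simp: K_def)
      then show "isCont w x" using hess_w has_hess_isCont by blast
    qed
    then obtain z where z: "z \<in> K" and zmax: "\<And>y. y \<in> K \<Longrightarrow> w y \<le> w z"
      using continuous_attains_sup[OF K] x0K by blast
    have wz: "w z > 0" using zmax[OF x0K] wx0 by simp
    have zn: "norm z < r" "\<rho> < norm z"
      using z outer_neg[of z] inner_neg[of z] wz \<rho> by (force simp: K_def)+
    have "\<forall>\<^sub>F y in nhds z. y \<in> ball 0 r - cball 0 \<rho>"
      using zn by (intro eventually_nhds_in_open open_Diff) auto
    then have "\<forall>\<^sub>F y in nhds z. w y \<le> w z"
      by eventually_elim (rule zmax, auto simp: K_def)
    moreover have "z \<in> ball 0 2 - {0}" using zn r \<rho> by auto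
    then obtain G H where "has_hess w G H z" "trace H > 0"
      using hess_w by blast
    ultimately show False using trace_nonpos_at_max by fastforce
  qed
  show ?thesis
  proof (rule ccontr)
    assume "\<not> ?thesis"
    then have d: "c + p \<bullet> x0 - u x0 > 0" by simp
    define L where "L = ln (r\<^sup>2 / (x0 \<bullet> x0))"
    define k where "k = \<bar>L\<bar> + 1"
    define e where "e = (c + p \<bullet> x0 - u x0) / (2 * k)"
    have k: "k > 0" by (simp add: k_def)
    then have e: "e > 0" using d by (simp add: e_def)
    from barrier[OF this] have "c + p \<bullet> x0 - u x0 \<le> e * L" by (simp add: L_def)
    also have "\<dots> \<le> e * k" using e by (intro mult_left_mono) (auto simp: k_def)
    also have "\<dots> = (c + p \<bullet> x0 - u x0) / 2" using k by (simp add: e_def)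
    finally show False using d by simp
  qed
qed

section \<open>The conformal factor as a subsolution\<close>

text \<open>
  This is the identity \<open>A\<^sup>u = \<xi> D\<^sup>2\<xi> - (1/2) |\<nabla>\<xi>|\<^sup>2 I\<close>. The exponent \<open>a\<close> is the one
  for which the terms in \<open>\<nabla>u \<otimes> \<nabla>u\<close> on both sides agree; the remaining multiple \<open>t\<close> of the
  identity is \<open>(1/2) |\<nabla>\<xi>|\<^sup>2\<close>.
\<close>

lemma has_hess_conformal_factor:
  fixes u :: "real^'n \<Rightarrow> real"
  assumes n: "CARD('n) \<ge> 3" and u: "has_hess u (grad u) (hess u x) x" "u x > 0"
    and a: "a = 2 / (real CARD('n) - 2)"
  shows "\<exists>G H t. has_hess (\<lambda>z. u z powr - a) G H x \<and>
    (u x powr - a) *\<^sub>R H = conf_mat u x + t *\<^sub>R mat 1 \<and> t \<ge> 0"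
proof -
  define N where "N = real CARD('n)"
  obtain m where m: "m > 0" "N = m + 2"
    using n that[of "N - 2"] by (auto simp: N_def)
  have e1: "- a + (- a - 1) = - ((N + 2) / (N - 2))" and e2: "- a + (- a - 1 - 1) = - (2 * N / (N - 2))"
    and e3: "a * (a + 1) = 2 * N / (N - 2)\<^sup>2"
    using m(1) unfolding a N_def[symmetric] m(2) by (simp_all add: field_simps power2_eq_square)
  have "\<forall>\<^sub>F t in nhds (u x). (0::real) < t"
    using u(2) eventually_nhds_in_open[of "{0<..}" "u x"] by simp
  then have 1: "\<forall>\<^sub>F t in nhds (u x). ((\<lambda>t. t powr - a) has_real_derivative - a * t powr (- a - 1)) (at t)"
    by eventually_elim (auto intro!: derivative_eq_intros)
  have 2: "((\<lambda>t. - a * t powr (- a - 1)) has_real_derivative - a * ((- a - 1) * u x powr (- a - 1 - 1))) (at (u x))"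
    using u(2) by (auto intro!: derivative_eq_intros)
  define H where "H = (- a * ((- a - 1) * u x powr (- a - 1 - 1))) *\<^sub>R outer (grad u x) (grad u x)
      + (- a * u x powr (- a - 1)) *\<^sub>R hess u x"
  define t where "t = 2 / (N - 2)\<^sup>2 * u x powr (- (2 * N / (N - 2))) * (norm (grad u x))\<^sup>2"
  have c1: "u x powr - a * (- a * ((- a - 1) * u x powr (- a - 1 - 1)))
      = 2 * N / (N - 2)\<^sup>2 * u x powr (- (2 * N / (N - 2)))"
    unfolding e2[symmetric] e3[symmetric] powr_add by (simp add: algebra_simps)
  have c2: "u x powr - a * (- a * u x powr (- a - 1)) = - (2 / (N - 2) * u x powr (- ((N + 2) / (N - 2))))"
    unfolding e1[symmetric] powr_add by (simp add: a N_def)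
  have "(u x powr - a) *\<^sub>R H = conf_mat u x + t *\<^sub>R mat 1"
    unfolding H_def scaleR_add_right scaleR_scaleR c1 c2
    by (simp add: conf_mat_def Let_def t_def N_def[symmetric])
  moreover have "has_hess (\<lambda>z. u z powr - a) (\<lambda>z. (- a * u z powr (- a - 1)) *\<^sub>R grad u z) H x"
    unfolding H_def by (rule has_hess_compose[OF u(1) 1 2])
  moreover have "t \<ge> 0" by (simp add: t_def)
  ultimately show ?thesis by blast
qed

text \<open>
  At a maximum the Hessian \<open>F\<close> of the displayed function is negative semidefinite. Solving
  \<open>F = D\<^sup>2\<xi> - c D\<^sup>2\<eta> + 2 e I\<close> for \<open>D\<^sup>2\<eta>\<close> and inserting the formula for \<open>\<xi> D\<^sup>2\<xi>\<close>
  exhibits a positive multiple of \<open>D\<^sup>2\<eta>\<close> as \<open>A\<^sup>u\<close> plus a matrix bounded below by \<open>2 e \<xi> I\<close>,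
  so \<open>D\<^sup>2\<eta> \<in> U\<close>, a contradiction. The quadratic term \<open>e |x|\<^sup>2\<close> is what makes the argument work
  when \<open>A\<^sup>u\<close> lies only in the closure of \<open>U\<close>, even where gradients vanish. The function is
  displayed in the shape that the rules for \<^const>\<open>has_hess\<close> produce.
\<close>

lemma no_interior_maximum:
  fixes U :: "(real^'n^'n) set"
  assumes n: "CARD('n) \<ge> 3" and a: "a = 2 / (real CARD('n) - 2)"
    and U: "U \<subseteq> sym_mats" and add: "\<And>M N. M \<in> U \<Longrightarrow> N \<in> pd_mats \<Longrightarrow> M + N \<in> U"
    and cone: "\<And>M k. M \<in> U \<Longrightarrow> k > 0 \<Longrightarrow> k *\<^sub>R M \<in> U"
    and u: "C2_on (ball 0 2 - {0}) u" "x \<in> ball 0 2 - {0}" "u x > 0" "conf_mat u x \<in> closure U"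
    and \<eta>: "C2_on (ball 0 2 - {0}) \<eta>" "x - y \<in> ball 0 2 - {0}" "hess \<eta> (x - y) \<notin> U"
    and c: "c > 0" and e: "e > 0"
  shows "\<not> (\<forall>\<^sub>F z in nhds x.
      (u z powr - a + (-c) * \<eta> (z - y)) + (e * (z \<bullet> z) + (0 + p \<bullet> z))
      \<le> (u x powr - a + (-c) * \<eta> (x - y)) + (e * (x \<bullet> x) + (0 + p \<bullet> x)))"
proof
  assume mx: "\<forall>\<^sub>F z in nhds x.
      (u z powr - a + (-c) * \<eta> (z - y)) + (e * (z \<bullet> z) + (0 + p \<bullet> z))
      \<le> (u x powr - a + (-c) * \<eta> (x - y)) + (e * (x \<bullet> x) + (0 + p \<bullet> x))"
  have opn: "open (ball 0 2 - {0} :: (real^'n) set)" by (simp add: open_delete)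
  obtain G H t where \<xi>: "has_hess (\<lambda>z. u z powr - a) G H x"
    and conf: "(u x powr - a) *\<^sub>R H = conf_mat u x + t *\<^sub>R mat 1" and t: "t \<ge> 0"
    using has_hess_conformal_factor[OF n C2_on_has_hess[OF u(1) opn u(2)] u(3) a] by blast
  define k where "k = u x powr - a"
  have k: "k > 0" using u(3) by (simp add: k_def)
  note h\<eta> = C2_on_has_hess[OF \<eta>(1) opn \<eta>(2)]
  define E where "E = hess \<eta> (x - y)"
  define F where "F = (H + (-c) *\<^sub>R E) + (e *\<^sub>R (2 *\<^sub>R mat 1) + 0)"
  have F: "v \<bullet> (F *v v) \<le> 0" for v
    unfolding F_def E_def
    by (rule second_derivative_test_max[OF has_hess_add[OF
          has_hess_add[OF \<xi> has_hess_scale[OF has_hess_shift[OF h\<eta>]]]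
          has_hess_add[OF has_hess_scale[OF has_hess_norm_square] has_hess_affine]] mx])
  define N where "N = (t + 2 * e * k) *\<^sub>R mat 1 - k *\<^sub>R F"
  have NE: "(k * c) *\<^sub>R E = conf_mat u x + N"
  proof -
    have "conf_mat u x = k *\<^sub>R H - t *\<^sub>R mat 1" using conf by (simp add: k_def)
    then show ?thesis by (simp add: N_def F_def algebra_simps)
  qed
  have "conf_mat u x + N \<in> U"
  proof (rule closure_add_uniformly_pd[OF U add u(4)])
    have "transpose (conf_mat u x) = conf_mat u x"
      using closure_minimal[OF U closed_sym_mats] u(4) by (auto simp: sym_mats_def)
    moreover have "transpose E = E" using has_hess_symmetric[OF h\<eta>] by (simp add: E_def)
    moreover have "N = (k * c) *\<^sub>R E - conf_mat u x" using NE by simp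
    ultimately show "N \<in> sym_mats"
      by (simp add: sym_mats_def transpose_def vec_eq_iff)
    show "2 * e * k > 0" using e k by simp
    fix v :: "real^'n"
    have "k * (v \<bullet> (F *v v)) \<le> 0" using F[of v] k by (simp add: mult_nonneg_nonpos)
    moreover have "t * (v \<bullet> v) \<ge> 0" using t by simp
    ultimately show "2 * e * k * (v \<bullet> v) \<le> v \<bullet> (N *v v)"
      by (simp add: N_def matrix_vector_mult_diff_rdistrib scaleR_matrix_vector_assoc[symmetric]
          inner_diff_right distrib_right)
  qed
  from cone[OF this, of "1 / (k * c)"] have "E \<in> U" using k c unfolding NE[symmetric] by simp
  then show False using \<eta>(3) by (simp add: E_def)
qed

section \<open>Removing the puncture and the comparison estimate\<close>

text \<open>
  If \<open>\<xi>\<close> lies below a downward cone with vertex value \<open>b\<close> at \<open>0\<close>, then \<open>\<xi>\<close> stays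
  below \<open>b\<close> by a definite amount near \<open>0\<close>. Indeed \<open>b > 0\<close>, as adding the bounds at two
  antipodal points shows. The map \<open>t \<mapsto> t powr -s\<close> with \<open>s = 1/a\<close> lies above its tangent at \<open>b\<close>,
  which turns the upper bound for \<open>\<xi>\<close> on the sphere of radius \<open>r\<close> into the affine lower bound
  \<open>c + p \<cdot> x\<close> for \<open>u\<close>. The cone contributes the surplus \<open>c > B\<close>, where \<open>B = b powr -s\<close>,
  and the minimum principle carries this surplus to the puncture.
\<close>

lemma no_conical_upper_contact_at_puncture:
  fixes u :: "real^'n \<Rightarrow> real"
  assumes n: "CARD('n) \<ge> 3" and a: "a = 2 / (real CARD('n) - 2)"
    and u: "positive_superharmonic u" and r0: "r0 > 0" and d: "d > 0"
    and ub: "\<And>x. 0 < norm x \<Longrightarrow> norm x < r0 \<Longrightarrow> u x powr - a \<le> b + q \<bullet> x - d * norm x"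
  shows "\<exists>\<tau>>0. \<exists>r>0. \<forall>x. 0 < norm x \<and> norm x < r \<longrightarrow> u x powr - a \<le> b - \<tau>"
proof -
  have pos: "u x > 0" if "0 < norm x" "norm x < 2" for x
    using u that by (auto simp: positive_superharmonic_def)
  define s where "s = 1 / a"
  have a0: "a > 0" using n by (simp add: a)
  have s: "s > 0" "a * s = 1" using a0 by (auto simp: s_def)
  define r where "r = min r0 1 / 2"
  have r: "0 < r" "r < r0" "r < 2" using r0 by (auto simp: r_def)
  have b: "b > d * r"
  proof -
    define x :: "real^'n" where "x = r *\<^sub>R axis undefined 1"
    have nx: "norm x = r" "norm (- x) = r" using r by (simp_all add: x_def)
    have "0 < u x powr - a" "0 < u (- x) powr - a"
      using pos[of x] pos[of "- x"] r nx by auto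
    moreover have "u x powr - a \<le> b + q \<bullet> x - d * r" "u (- x) powr - a \<le> b - q \<bullet> x - d * r"
      using ub[of x] ub[of "- x"] r nx by simp_all
    ultimately show ?thesis by linarith
  qed
  then have b0: "b > 0" using mult_pos_pos[OF d r(1)] by linarith
  define B where "B = b powr - s"
  have B: "B > 0" using b0 by (simp add: B_def)
  define c where "c = B * (1 + s * d * r / b)"
  define p where "p = (- (B * s / b)) *\<^sub>R q"
  have cB: "c > B" using B s d r b0 by (simp add: c_def distrib_left)
  have sphere: "c + p \<bullet> x \<le> u x" if x: "norm x = r" for x
  proof -
    define T where "T = b + q \<bullet> x - d * r"
    have ux: "u x > 0" using pos[of x] x r by simp
    have le: "u x powr - a \<le> T" using ub[of x] x r by (simp add: T_def)
    then have T: "T > 0" using ux by (smt (verit) powr_gt_zero)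
    have "c + p \<bullet> x = B * (1 - s * (T / b - 1))"
      using b0 by (simp add: c_def p_def T_def field_simps)
    \<comment> \<open>the tangent inequality, from \<open>1 + z \<le> exp z\<close> and \<open>ln z \<le> z - 1\<close>\<close>
    also have "\<dots> \<le> B * exp (- s * ln (T / b))"
    proof (intro mult_left_mono)
      have "ln (T / b) \<le> T / b - 1" using T b0 by (intro ln_le_minus_one) simp
      then have "s * ln (T / b) \<le> s * (T / b - 1)" using s by (intro mult_left_mono) auto
      then show "1 - s * (T / b - 1) \<le> exp (- s * ln (T / b))"
        using exp_ge_add_one_self[of "- s * ln (T / b)"] by simp
    qed (use B in simp)
    also have "\<dots> = T powr - s"
      using T b0 by (simp add: B_def powr_def ln_div algebra_simps flip: exp_add)
    also have "\<dots> \<le> (u x powr - a) powr - s"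
      using le ux s by (intro powr_mono2') auto
    also have "\<dots> = u x" using ux s by (simp add: powr_powr)
    finally show ?thesis .
  qed
  have inside: "c + p \<bullet> x \<le> u x" if "x \<in> ball 0 r - {0}" for x
    using punctured_minimum_principle[OF n r(1,3) u sphere that] .
  define c' where "c' = (B + c) / 2"
  have c': "B < c'" "c' < c" "c' > 0" using cB B by (auto simp: c'_def)
  define r1 where "r1 = min r ((c - c') / (norm p + 1))"
  have np: "norm p + 1 > 0" using norm_ge_zero[of p] by linarith
  have r1: "r1 > 0" using r c' np by (simp add: r1_def)
  have "u x powr - a \<le> b - (b - c' powr - a)" if x: "0 < norm x" "norm x < r1" for x
  proof -
    have "norm x * (norm p + 1) < c - c'"
      using x np by (simp add: r1_def pos_less_divide_eq)
    moreover have "norm x * (norm p + 1) = norm p * norm x + norm x" by (simp add: algebra_simps)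
    ultimately have "norm p * norm x \<le> c - c'"
      using x(1) by linarith
    then have "c' \<le> c + p \<bullet> x"
      using Cauchy_Schwarz_ineq2[of p x] by linarith
    also have "\<dots> \<le> u x" using x by (intro inside) (auto simp: r1_def)
    finally have "u x powr - a \<le> c' powr - a" using c' a0 by (intro powr_mono2') auto
    then show ?thesis by simp
  qed
  moreover have "b - c' powr - a > 0"
  proof -
    have "c' powr - a < B powr - a"
      using c' B a0 by (intro powr_less_mono2_neg) auto
    also have "\<dots> = b" using b0 s by (simp add: B_def powr_powr mult.commute)
    finally show ?thesis by simp
  qed
  ultimately show ?thesis using r1 by blast
qed

text \<open>
  The constant \<open>\<mu> powr -a / m\<close> is chosen such that the barrier dominates \<open>\<xi> \<le> \<mu> powr -a\<close> on the
  unit sphere. Were the inequality false at \<open>x1\<close>, by \<open>3 k\<close> say, perturbations of size at most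
  \<open>k\<close> could not move the maximum to the sphere or to \<open>y\<close>, and the interior is excluded by
  \<open>no_interior_maximum\<close>. So the supremum \<open>S p\<close> of each perturbed function \<open>\<Phi> p\<close> over the
  punctured ball \<open>D\<close> is approached only at \<open>0\<close>, is independent of \<open>p\<close>, and bounds \<open>\<xi>\<close> by a cone
  near \<open>0\<close> whose vertex value is also approached by \<open>\<xi>\<close>. This contradicts
  \<open>no_conical_upper_contact_at_puncture\<close>.
\<close>

lemma comparison_with_translated_barrier:
  fixes U :: "(real^'n^'n) set"
  assumes n: "CARD('n) \<ge> 3" and a: "a = 2 / (real CARD('n) - 2)"
    and U: "U \<subseteq> sym_mats" and add: "\<And>M N. M \<in> U \<Longrightarrow> N \<in> pd_mats \<Longrightarrow> M + N \<in> U"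
    and cone: "\<And>M k. M \<in> U \<Longrightarrow> k > 0 \<Longrightarrow> k *\<^sub>R M \<in> U"
    and \<eta>: "C2_on (ball 0 2 - {0}) \<eta>" "continuous_on (ball 0 2) \<eta>" "\<eta> 0 = 0"
      "\<And>x. x \<in> ball 0 2 - {0} \<Longrightarrow> \<eta> x > 0"
    and \<eta>U: "\<And>x. x \<in> ball 0 2 - {0} \<Longrightarrow> hess \<eta> x \<notin> U"
    and u: "positive_superharmonic u"
    and uU: "\<And>x. x \<in> ball 0 2 - {0} \<Longrightarrow> conf_mat u x \<in> closure U"
    and \<mu>: "\<mu> > 0" "\<And>x. norm x = 1 \<Longrightarrow> \<mu> \<le> u x"
    and m: "m > 0" "\<And>x. 3/4 \<le> norm x \<Longrightarrow> norm x \<le> 5/4 \<Longrightarrow> m \<le> \<eta> x"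
    and x1: "x1 \<in> ball 0 1 - {0}" and y: "y \<in> ball 0 (1/4) - {0}"
  shows "u x1 powr - a - u y powr - a \<le> \<mu> powr - a / m * \<eta> (x1 - y)"
proof (rule ccontr)
  assume nle: "\<not> ?thesis"
  have opn: "open (ball 0 2 - {0} :: (real^'n) set)" by (simp add: open_delete)
  have C2: "C2_on (ball 0 2 - {0}) u" and pos: "\<And>x. x \<in> ball 0 2 - {0} \<Longrightarrow> u x > 0"
    using u by (auto simp: positive_superharmonic_def)
  define c where "c = \<mu> powr - a / m"
  have c: "c > 0" using m \<mu> by (simp add: c_def)
  have a0: "a > 0" using n by (simp add: a)
  define D :: "(real^'n) set" where "D = cball 0 1 - {0}"
  define \<Psi> where "\<Psi> x = u x powr - a + (-c) * \<eta> (x - y)" for x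
  define k where "k = (\<Psi> x1 - u y powr - a) / 3"
  define e where "e = k / 2"
  have k: "k > 0" using nle by (simp add: k_def \<Psi>_def c_def)
  then have e: "e > 0" by (simp add: e_def)
  define \<Phi> where "\<Phi> p x = \<Psi> x + (e * (x \<bullet> x) + (0 + p \<bullet> x))" for p x
  have x1D: "x1 \<in> D" using x1 by (simp add: D_def)
  have xy: "norm (x - y) < 2" if "norm x \<le> 1" for x
    using norm_triangle_ineq4[of x y] that y by simp
  have \<eta>nonneg: "\<eta> z \<ge> 0" if "norm z < 2" for z
    using \<eta>(3) \<eta>(4)[of z] that by (cases "z = 0") auto
  have \<xi>le: "u x powr - a \<le> \<mu> powr - a" if x: "x \<in> D" for x
  proof -
    have "\<mu> \<le> u x"
    proof (cases "norm x = 1")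
      case False
      then show ?thesis
        using punctured_minimum_principle[OF n _ _ u, of 1 \<mu> 0 x] \<mu>(2) x by (simp add: D_def)
    qed (rule \<mu>(2))
    then show ?thesis using \<mu>(1) a0 by (intro powr_mono2') auto
  qed
  have \<Phi>\<Psi>: "\<Psi> x - e \<le> \<Phi> p x" "\<Phi> p x \<le> \<Psi> x + k" if p: "norm p \<le> e" and x: "x \<in> D" for p x
  proof -
    have "norm x \<le> 1" using x by (simp add: D_def)
    then have "norm p * norm x \<le> e * 1"
      using p e by (intro mult_mono) auto
    moreover have "x \<bullet> x \<le> 1"
      unfolding dot_square_norm using \<open>norm x \<le> 1\<close> by (intro power_le_one) auto
    then have "e * (x \<bullet> x) \<le> e * 1" using e by (intro mult_left_mono) auto
    moreover have "0 \<le> e * (x \<bullet> x)" using e by simp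
    ultimately have "\<bar>p \<bullet> x\<bar> \<le> e" "0 \<le> e * (x \<bullet> x)" "e * (x \<bullet> x) \<le> e"
      using Cauchy_Schwarz_ineq2[of p x] by auto
    moreover have "k = 2 * e" by (simp add: e_def)
    ultimately show "\<Psi> x - e \<le> \<Phi> p x" "\<Phi> p x \<le> \<Psi> x + k"
      unfolding \<Phi>_def by linarith+
  qed
  have no_max: "\<exists>x\<in>D. \<Phi> p z < \<Phi> p x" if p: "norm p \<le> e" and z: "z \<in> D" for p z
  proof (rule ccontr)
    assume "\<not> ?thesis"
    then have mx: "\<And>x. x \<in> D \<Longrightarrow> \<Phi> p x \<le> \<Phi> p z" by force
    have "\<Psi> x1 = u y powr - a + 3 * k" by (simp add: k_def field_simps)
    then have big: "\<Psi> z > u y powr - a"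
      using mx[OF x1D] \<Phi>\<Psi>(1)[OF p x1D] \<Phi>\<Psi>(2)[OF p z] k by (simp add: e_def)
    have "z \<noteq> y" using big \<eta>(3) by (auto simp: \<Psi>_def)
    moreover have "norm z \<noteq> 1"
    proof
      assume z1: "norm z = 1"
      have "m \<le> \<eta> (z - y)"
        using norm_triangle_ineq4[of z y] norm_triangle_ineq2[of z y] y z1 by (intro m(2)) auto
      then have "\<mu> powr - a \<le> c * \<eta> (z - y)"
        using m(1) \<mu>(1) by (simp add: c_def field_simps)
      then have "\<Psi> z \<le> 0" using \<xi>le[OF z] by (simp add: \<Psi>_def)
      then show False using big by (smt (verit) powr_ge_zero)
    qed
    ultimately have z': "norm z < 1" "z \<noteq> 0" "z - y \<in> ball 0 2 - {0}"
      using z xy[of z] by (auto simp: D_def)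
    then have "\<forall>\<^sub>F x in nhds z. x \<in> ball 0 1 - {0}"
      by (intro eventually_nhds_in_open) (auto simp: open_delete)
    then have "\<forall>\<^sub>F x in nhds z. \<Phi> p x \<le> \<Phi> p z"
      by eventually_elim (rule mx, auto simp: D_def)
    moreover have "z \<in> ball 0 2 - {0}" using z' by simp
    ultimately show False
      using no_interior_maximum[OF n a U add cone C2 _ pos uU \<eta>(1) z'(3) \<eta>U c e, of p] z'(3)
      unfolding \<Phi>_def \<Psi>_def by blast
  qed
  have cont: "continuous_on D (\<Phi> p)" for p
  proof -
    have "continuous_on D u"
      using has_hess_isCont[OF C2_on_has_hess[OF C2 opn]]
      by (intro continuous_at_imp_continuous_on) (auto simp: D_def)
    moreover have "continuous_on D (\<lambda>x. \<eta> (x - y))"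
      by (rule continuous_on_compose2[OF \<eta>(2)]) (auto intro!: continuous_intros xy simp: D_def)
    moreover have "\<forall>x\<in>D. u x \<noteq> 0" using pos by (force simp: D_def)
    ultimately show ?thesis
      unfolding \<Phi>_def \<Psi>_def by (intro continuous_intros)
  qed
  define S where "S p = Sup (\<Phi> p ` D)" for p
  have bdd: "bdd_above (\<Phi> p ` D)" if p: "norm p \<le> e" for p
  proof (rule bdd_aboveI2)
    fix x assume x: "x \<in> D"
    then have "0 \<le> c * \<eta> (x - y)" using c xy \<eta>nonneg by (auto simp: D_def)
    then show "\<Phi> p x \<le> \<mu> powr - a + k"
      using \<Phi>\<Psi>(2)[OF p x] \<xi>le[OF x] by (simp add: \<Psi>_def)
  qed
  have leS: "\<Phi> p x \<le> S p" if "norm p \<le> e" "x \<in> D" for p x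
    unfolding S_def using bdd that by (intro cSup_upper) auto
  have near_sup: "\<exists>x\<in>D. norm x < r \<and> \<Phi> p x > S p - \<tau>"
    if p: "norm p \<le> e" and r: "r > 0" and \<tau>: "\<tau> > 0" for p r \<tau>
  proof -
    define K where "K = cball 0 1 - ball (0 :: real^'n) r"
    have KD: "K \<subseteq> D" using r by (auto simp: K_def D_def)
    have "\<exists>v < S p. \<forall>x\<in>K. \<Phi> p x \<le> v"
    proof (cases "K = {}")
      case True
      then show ?thesis using lt_ex by auto
    next
      case False
      have "compact K" by (simp add: K_def compact_diff)
      then obtain z where z: "z \<in> K" "\<And>x. x \<in> K \<Longrightarrow> \<Phi> p x \<le> \<Phi> p z"
        using continuous_attains_sup[OF _ False continuous_on_subset[OF cont KD]] by blast
      then have "\<Phi> p z < S p" using no_max[OF p, of z] leS[OF p] KD by fastforce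
      then show ?thesis using z by blast
    qed
    then obtain v where v: "v < S p" "\<And>x. x \<in> K \<Longrightarrow> \<Phi> p x \<le> v" by blast
    have "max v (S p - \<tau>) < Sup (\<Phi> p ` D)" using v(1) \<tau> by (simp add: S_def)
    then obtain x where x: "x \<in> D" "max v (S p - \<tau>) < \<Phi> p x"
      using less_cSup_iff[OF _ bdd[OF p]] x1D by blast
    then have "x \<notin> K" using v(2) by fastforce
    then show ?thesis using x by (auto simp: K_def D_def)
  qed
  \<comment> \<open>near \<open>0\<close>, where both suprema are approached, \<open>\<Phi> p\<close> and \<open>\<Phi> q\<close> differ arbitrarily little\<close>
  have S_le: "S p \<le> S q" if p: "norm p \<le> e" and q: "norm q \<le> e" for p q
  proof (rule field_le_epsilon)
    fix \<tau> :: real assume \<tau>: "\<tau> > 0"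
    obtain x where x: "x \<in> D" "norm x < \<tau> / (4 * e)" "\<Phi> p x > S p - \<tau> / 2"
      using near_sup[OF p, of "\<tau> / (4 * e)" "\<tau> / 2"] \<tau> e by auto
    have "(p - q) \<bullet> x \<le> norm (p - q) * norm x" by (rule norm_cauchy_schwarz)
    also have "\<dots> \<le> (2 * e) * (\<tau> / (4 * e))"
      using norm_triangle_ineq4[of p q] p q x(2) \<tau> e by (intro mult_mono) auto
    also have "\<dots> = \<tau> / 2" using e by simp
    finally have "\<Phi> p x - \<Phi> q x \<le> \<tau> / 2" by (simp add: \<Phi>_def inner_diff_left)
    then show "S p \<le> S q + \<tau>" using leS[OF q x(1)] x(3) by linarith
  qed
  have cone_bound: "\<Psi> x \<le> S 0 - e * norm x" if x: "x \<in> D" for x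
  proof -
    have nx: "norm x > 0" using x by (simp add: D_def)
    \<comment> \<open>among the admissible linear terms, the one that is largest at \<open>x\<close>\<close>
    define p where "p = (e / norm x) *\<^sub>R x"
    have p: "norm p \<le> e" using nx e by (simp add: p_def)
    have "p \<bullet> x = e * norm x"
      using nx by (simp add: p_def dot_square_norm power2_eq_square)
    moreover have "\<Phi> p x \<le> S 0" using leS[OF p x] S_le[OF p, of 0] e by simp
    moreover have "0 \<le> e * (x \<bullet> x)" using e by simp
    ultimately show ?thesis by (simp add: \<Phi>_def)
  qed
  \<comment> \<open>at \<open>0\<close> the barrier is differentiable because its pole \<open>y\<close> is elsewhere; half of the cone
    pays for the error of the linearization\<close>
  have y2: "- y \<in> ball 0 2 - {0}" using y by auto
  define q where "q = c *\<^sub>R grad \<eta> (- y)"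
  have "(\<eta> has_derivative (\<lambda>h. grad \<eta> (- y) \<bullet> h)) (at (- y))"
    using \<eta>(1) y2 by (intro has_derivative_grad) (auto simp: C2_on_def)
  moreover have "e / (2 * c) > 0" using e c by simp
  ultimately obtain r0 where r0: "r0 > 0" and lin: "\<And>z. norm (z - - y) < r0 \<Longrightarrow>
      norm (\<eta> z - \<eta> (- y) - grad \<eta> (- y) \<bullet> (z - - y)) \<le> e / (2 * c) * norm (z - - y)"
    unfolding has_derivative_at_alt by blast
  have lin': "\<bar>c * \<eta> (x - y) - c * \<eta> (- y) - q \<bullet> x\<bar> \<le> e / 2 * norm x" if "norm x < r0" for x
  proof -
    have "c * \<bar>\<eta> (x - y) - \<eta> (- y) - grad \<eta> (- y) \<bullet> x\<bar> \<le> c * (e / (2 * c) * norm x)"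
      using lin[of "x - y"] that c by (intro mult_left_mono) auto
    moreover have "c * \<bar>\<eta> (x - y) - \<eta> (- y) - grad \<eta> (- y) \<bullet> x\<bar>
        = \<bar>c * (\<eta> (x - y) - \<eta> (- y) - grad \<eta> (- y) \<bullet> x)\<bar>"
      using c by (simp add: abs_mult)
    ultimately show ?thesis using c by (simp add: q_def right_diff_distrib)
  qed
  define b where "b = S 0 + c * \<eta> (- y)"
  have "u x powr - a \<le> b + q \<bullet> x - e / 2 * norm x" if "0 < norm x" "norm x < min r0 1" for x
  proof -
    have "u x powr - a - c * \<eta> (x - y) \<le> S 0 - e * norm x"
      using cone_bound[of x] that by (simp add: \<Psi>_def D_def)
    then show ?thesis using lin'[of x] that unfolding b_def by linarith
  qed
  then obtain \<tau> r where \<tau>: "\<tau> > 0" and r: "r > 0"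
    and drop: "\<And>x. 0 < norm x \<Longrightarrow> norm x < r \<Longrightarrow> u x powr - a \<le> b - \<tau>"
    using no_conical_upper_contact_at_puncture[OF n a u, of "min r0 1" "e / 2" b q] r0 e by auto
  \<comment> \<open>so close to \<open>0\<close> that the linear, conical and quadratic terms together stay below \<open>\<tau> / 4\<close>\<close>
  define \<rho> where "\<rho> = Min {r, r0, 1, \<tau> / (4 * (norm q + 2 * e))}"
  have qe: "norm q + 2 * e > 0" using e norm_ge_zero[of q] by linarith
  have \<rho>: "\<rho> > 0" using r r0 \<tau> qe by (simp add: \<rho>_def)
  obtain x where x: "x \<in> D" "norm x < \<rho>" "\<Phi> 0 x > S 0 - \<tau> / 2"
    using near_sup[of 0 \<rho> "\<tau> / 2"] \<rho> \<tau> e by auto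
  have xs: "norm x < r" "norm x < r0" "norm x < 1" "norm x < \<tau> / (4 * (norm q + 2 * e))"
    using x(2) by (auto simp: \<rho>_def)
  have "e * (x \<bullet> x) \<le> e * norm x"
    unfolding dot_square_norm power2_eq_square
    using xs(3) e by (intro mult_left_mono mult_left_le) auto
  moreover have "\<bar>q \<bullet> x\<bar> \<le> norm q * norm x" by (rule Cauchy_Schwarz_ineq2)
  moreover have "norm x * (norm q + 2 * e) < \<tau> / 4"
    using xs(4) qe by (simp add: field_simps)
  moreover have "norm x * (norm q + 2 * e) = norm q * norm x + 2 * (e * norm x)"
    by (simp add: algebra_simps)
  moreover have "0 \<le> e * norm x" using e by simp
  moreover have "u x powr - a - c * \<eta> (x - y) + e * (x \<bullet> x) > S 0 - \<tau> / 2"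
    using x(3) by (simp add: \<Phi>_def \<Psi>_def)
  ultimately have "u x powr - a > b - \<tau>"
    using lin'[OF xs(2)] unfolding b_def by linarith
  then show False using drop[of x] x(1) xs(1) by (simp add: D_def)
qed

section \<open>Passage to the limit and continuous extension\<close>

text \<open>
  Any \<open>\<nu> < \<mu>\<close> is eventually a lower bound of the approximating functions on the unit sphere, by
  uniform convergence there. The bounds for the approximating functions with \<open>\<nu>\<close> in
  place of \<open>\<mu>\<close> then pass to the limit pointwise, and finally \<open>\<nu>\<close> tends to \<open>\<mu>\<close>.
\<close>

lemma locally_uniform_limit_estimates:
  fixes U :: "(real^'n^'n) set" and ui :: "nat \<Rightarrow> real^'n \<Rightarrow> real"
  assumes n: "CARD('n) \<ge> 3" and a: "a = 2 / (real CARD('n) - 2)"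
    and U: "U \<subseteq> sym_mats" and add: "\<And>M N. M \<in> U \<Longrightarrow> N \<in> pd_mats \<Longrightarrow> M + N \<in> U"
    and cone: "\<And>M k. M \<in> U \<Longrightarrow> k > 0 \<Longrightarrow> k *\<^sub>R M \<in> U"
    and \<eta>: "C2_on (ball 0 2 - {0}) \<eta>" "continuous_on (ball 0 2) \<eta>" "\<eta> 0 = 0"
      "\<And>x. x \<in> ball 0 2 - {0} \<Longrightarrow> \<eta> x > 0"
    and \<eta>U: "\<And>x. x \<in> ball 0 2 - {0} \<Longrightarrow> hess \<eta> x \<notin> U"
    and m: "m > 0" "\<And>x. 3/4 \<le> norm x \<Longrightarrow> norm x \<le> 5/4 \<Longrightarrow> m \<le> \<eta> x"
    and ui: "\<And>i. positive_superharmonic (ui i)"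
      "\<And>i x. x \<in> ball 0 2 - {0} \<Longrightarrow> conf_mat (ui i) x \<in> closure U"
    and lim: "\<And>K. compact K \<Longrightarrow> K \<subseteq> ball 0 2 - {0} \<Longrightarrow> uniform_limit K ui u sequentially"
    and pos: "\<And>x. x \<in> ball 0 2 - {0} \<Longrightarrow> u x > 0"
    and \<mu>: "\<mu> > 0" "\<And>x. norm x = 1 \<Longrightarrow> \<mu> \<le> u x"
    and x: "x \<in> ball 0 1 - {0}"
  shows "\<mu> \<le> u x"
    and "y \<in> ball 0 (1/4) - {0} \<Longrightarrow> u x powr - a - u y powr - a \<le> \<mu> powr - a / m * \<eta> (x - y)"
proof -
  have pw: "(\<lambda>i. ui i z) \<longlonglongrightarrow> u z" if "z \<in> ball 0 2 - {0}" for z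
    using tendsto_uniform_limitI[OF lim[of "{z}"]] that by simp
  have ev: "\<forall>\<^sub>F i in sequentially. \<forall>z. norm z = 1 \<longrightarrow> \<nu> \<le> ui i z" if \<nu>: "\<nu> < \<mu>" for \<nu>
  proof -
    have "uniform_limit (sphere 0 1) ui u sequentially" by (intro lim) auto
    from uniform_limitD[OF this, of "\<mu> - \<nu>"] \<nu>
    have "\<forall>\<^sub>F i in sequentially. \<forall>z\<in>sphere 0 1. dist (ui i z) (u z) < \<mu> - \<nu>" by simp
    then show ?thesis
    proof eventually_elim
      case (elim i)
      show ?case
      proof (intro allI impI)
        fix z :: "real^'n" assume z: "norm z = 1"
        then have "dist (ui i z) (u z) < \<mu> - \<nu>" using elim by simp
        then show "\<nu> \<le> ui i z" using \<mu>(2)[OF z] by (simp add: dist_real_def)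
      qed
    qed
  qed
  show "\<mu> \<le> u x"
  proof (rule dense_le_bounded[OF \<mu>(1)])
    fix \<nu> assume \<nu>: "0 < \<nu>" "\<nu> < \<mu>"
    have "\<forall>\<^sub>F i in sequentially. \<nu> \<le> ui i x"
      using ev[OF \<nu>(2)]
    proof eventually_elim
      case (elim i)
      show ?case using punctured_minimum_principle[OF n _ _ ui(1), of 1 \<nu> 0 i x] elim x by simp
    qed
    then show "\<nu> \<le> u x" using pw[of x] x by (intro tendsto_lowerbound[of "\<lambda>i. ui i x"]) auto
  qed
  assume y: "y \<in> ball 0 (1/4) - {0}"
  have tend: "(\<lambda>i. ui i z powr - a) \<longlonglongrightarrow> u z powr - a" if "z \<in> ball 0 2 - {0}" for z
    using pw[OF that] pos[OF that] by (intro tendsto_powr) auto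
  have below: "u x powr - a - u y powr - a \<le> \<nu> powr - a / m * \<eta> (x - y)" if \<nu>: "0 < \<nu>" "\<nu> < \<mu>" for \<nu>
  proof (rule tendsto_upperbound)
    show "(\<lambda>i. ui i x powr - a - ui i y powr - a) \<longlonglongrightarrow> u x powr - a - u y powr - a"
      using x y by (intro tendsto_diff tend) auto
    show "\<forall>\<^sub>F i in sequentially. ui i x powr - a - ui i y powr - a \<le> \<nu> powr - a / m * \<eta> (x - y)"
      using ev[OF \<nu>(2)]
    proof eventually_elim
      case (elim i)
      then show ?case
        using comparison_with_translated_barrier[OF n a U add cone \<eta> \<eta>U ui(1) ui(2) \<nu>(1) _ m x y]
        by blast
    qed
  qed simp
  show "u x powr - a - u y powr - a \<le> \<mu> powr - a / m * \<eta> (x - y)"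
  proof (rule tendsto_lowerbound)
    show "((\<lambda>\<nu>. \<nu> powr - a / m * \<eta> (x - y)) \<longlongrightarrow> \<mu> powr - a / m * \<eta> (x - y)) (at_left \<mu>)"
      using \<mu>(1) m(1) by (intro tendsto_intros) auto
    show "\<forall>\<^sub>F \<nu> in at_left \<mu>. u x powr - a - u y powr - a \<le> \<nu> powr - a / m * \<eta> (x - y)"
      using eventually_at_left_real[OF \<mu>(1)] by eventually_elim (use below in auto)
  qed simp
qed

lemma min_on_attained:
  assumes "compact S" "S \<noteq> {}" "continuous_on S f"
  shows "\<exists>z\<in>S. min_on S f = f z \<and> (\<forall>x\<in>S. f z \<le> f x)"
proof -
  obtain z where z: "z \<in> S" "\<And>x. x \<in> S \<Longrightarrow> f z \<le> f x"
    using continuous_attains_inf[OF assms] by blast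
  then have "min_on S f = f z"
    unfolding min_on_def by (intro Least_equality) auto
  with z show ?thesis by blast
qed

lemma max_on_eqI:
  assumes "z \<in> S" "\<And>x. x \<in> S \<Longrightarrow> f x \<le> f z"
  shows "max_on S f = f z"
  unfolding max_on_def using assms by (intro Greatest_equality) auto

text \<open>
  The value \<open>L\<close> is a limit of \<open>f\<close> along some sequence tending to \<open>0\<close>, which exists because \<open>f\<close>
  is bounded. Passing to the limit in the oscillation bound along this sequence shows that
  \<open>f\<close> converges to \<open>L\<close>.
\<close>

lemma extension_by_modulus:
  fixes f :: "real^'n \<Rightarrow> real"
  assumes f: "continuous_on (ball 0 2 - {0}) f"
    and bd: "\<And>x. x \<in> ball 0 (1/4) - {0} \<Longrightarrow> 0 \<le> f x \<and> f x \<le> M"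
    and \<omega>: "continuous_on (ball 0 2) \<omega>" "\<omega> 0 = 0"
    and osc: "\<And>x y. x \<in> ball 0 (1/4) - {0} \<Longrightarrow> y \<in> ball 0 (1/4) - {0} \<Longrightarrow> \<bar>f x - f y\<bar> \<le> \<omega> (x - y)"
  shows "\<exists>L\<ge>0. continuous_on (ball 0 2) (\<lambda>x. if x = 0 then L else f x) \<and>
    (\<forall>x \<in> ball 0 (1/4) - {0}. \<bar>f x - L\<bar> \<le> \<omega> x)"
proof -
  define y :: "nat \<Rightarrow> real^'n" where "y k = inverse (real (Suc k)) *\<^sub>R ((1/5) *\<^sub>R axis undefined 1)" for k
  have y0: "y \<longlonglongrightarrow> 0"
    unfolding y_def
    using tendsto_scaleR[OF LIMSEQ_inverse_real_of_nat tendsto_const, of "(1/5) *\<^sub>R axis undefined 1"]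
    by simp
  have yb: "y k \<in> ball 0 (1/4) - {0}" for k
  proof -
    have "inverse (real (Suc k)) \<le> 1" by (simp add: field_simps)
    then show ?thesis by (simp add: y_def)
  qed
  have "seq_compact {0..M}" using compact_imp_seq_compact by blast
  then obtain L s where L: "L \<in> {0..M}" and s: "strict_mono s" and lim: "((\<lambda>k. f (y k)) \<circ> s) \<longlonglongrightarrow> L"
    using bd[OF yb] by (metis (no_types, lifting) atLeastAtMost_iff seq_compactE)
  have cont\<omega>: "isCont \<omega> x" if "norm x < 2" for x
    using \<omega>(1) that by (simp add: continuous_on_eq_continuous_at)
  have bound: "\<bar>f x - L\<bar> \<le> \<omega> x" if x: "x \<in> ball 0 (1/4) - {0}" for x
  proof (rule tendsto_le[OF sequentially_bot])
    show "(\<lambda>k. \<bar>f x - f (y (s k))\<bar>) \<longlonglongrightarrow> \<bar>f x - L\<bar>"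
      using lim by (intro tendsto_intros) (simp add: o_def)
    have "(\<lambda>k. x - y (s k)) \<longlonglongrightarrow> x - 0"
      using LIMSEQ_subseq_LIMSEQ[OF y0 s] by (intro tendsto_intros) (simp add: o_def)
    then show "(\<lambda>k. \<omega> (x - y (s k))) \<longlonglongrightarrow> \<omega> x"
      using x cont\<omega>[of x] by (intro isCont_tendsto_compose[of x \<omega>]) auto
    show "\<forall>\<^sub>F k in sequentially. \<bar>f x - f (y (s k))\<bar> \<le> \<omega> (x - y (s k))"
      using osc[OF x yb] by simp
  qed
  have lim0: "f \<midarrow>0\<rightarrow> L"
  proof (rule LIM_zero_cancel, rule Lim_null_comparison)
    show "\<forall>\<^sub>F x in at 0. norm (f x - L) \<le> \<omega> x"
      using bound unfolding eventually_at by (auto intro!: exI[of _ "1/4"])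
    show "\<omega> \<midarrow>0\<rightarrow> 0" using cont\<omega>[of 0] \<omega>(2) by (simp add: isCont_def)
  qed
  have "isCont (\<lambda>x. if x = 0 then L else f x) x" if "norm x < 2" for x
  proof (cases "x = 0")
    case True
    have "((\<lambda>x. if x = 0 then L else f x) \<longlongrightarrow> L) (at 0)"
      using lim0 by (rule Lim_transform_eventually) (auto simp: eventually_at_filter)
    then show ?thesis using True by (simp add: isCont_def)
  next
    case False
    have opn: "open (ball 0 2 - {0} :: (real^'n) set)" by (simp add: open_delete)
    have "isCont f x" using f opn False that by (simp add: continuous_on_eq_continuous_at)
    moreover have "\<forall>\<^sub>F z in nhds x. z \<in> ball 0 2 - {0}"
      using opn False that by (intro eventually_nhds_in_open) auto
    then have "\<forall>\<^sub>F z in nhds x. f z = (if z = 0 then L else f z)"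
      by eventually_elim auto
    ultimately show ?thesis using isCont_cong by fast
  qed
  then have "continuous_on (ball 0 2) (\<lambda>x. if x = 0 then L else f x)"
    by (intro continuous_at_imp_continuous_on) simp
  moreover have "L \<ge> 0" using L by simp
  ultimately show ?thesis using bound by blast
qed

lemma bounded_continuous_extension:
  fixes u :: "real^'n \<Rightarrow> real"
  assumes a: "a > 0" and pos: "\<And>x. x \<in> ball 0 2 - {0} \<Longrightarrow> u x > 0"
    and cont: "continuous_on (ball 0 2) (\<lambda>x. if x = 0 then L else u x powr - a)" and L: "L > 0"
  shows "(SUP x \<in> ball 0 1 - {0}. ereal (u x)) < \<infinity>"
    and "\<exists>v. continuous_on (ball 0 1) v \<and> (\<forall>x \<in> ball 0 1 - {0}. v x = u x)"
proof -
  define v where "v x = (if x = 0 then L else u x powr - a) powr (- (1 / a))" for x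
  have vu: "v x = u x" if "x \<in> ball 0 2 - {0}" for x
    using pos[OF that] that a by (simp add: v_def powr_powr)
  have v: "continuous_on (ball 0 2) v"
    unfolding v_def
  proof (intro continuous_on_powr cont continuous_on_const ballI)
    fix x :: "real^'n" assume "x \<in> ball 0 2"
    then show "(if x = 0 then L else u x powr - a) \<noteq> 0" using L pos[of x] by auto
  qed
  have "continuous_on (cball 0 1) v" by (rule continuous_on_subset[OF v]) auto
  then have "bounded (v ` cball 0 1)"
    by (intro compact_imp_bounded compact_continuous_image) auto
  then obtain B where B: "\<And>x. x \<in> cball 0 1 \<Longrightarrow> \<bar>v x\<bar> \<le> B"
    unfolding bounded_iff by (metis imageI real_norm_def)
  have "(SUP x \<in> ball 0 1 - {0}. ereal (u x)) \<le> ereal B"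
  proof (rule SUP_least)
    fix x :: "real^'n" assume "x \<in> ball 0 1 - {0}"
    then show "ereal (u x) \<le> ereal B" using B[of x] vu[of x] by simp
  qed
  then show "(SUP x \<in> ball 0 1 - {0}. ereal (u x)) < \<infinity>" by (rule le_less_trans) simp
  have "continuous_on (ball 0 1) v" by (rule continuous_on_subset[OF v]) auto
  then show "\<exists>v. continuous_on (ball 0 1) v \<and> (\<forall>x \<in> ball 0 1 - {0}. v x = u x)"
    using vu by (intro exI[of _ v]) auto
qed

text \<open>
  Near the puncture the bound \<open>u powr -a \<le> K \<omega>\<close> is inverted, which gives the constant
  \<open>K powr -(1/a)\<close>; on the remaining compact annulus the function is continuous and positive.
\<close>

lemma barrier_blow_up_rate:
  fixes u :: "real^'n \<Rightarrow> real"
  assumes a: "a > 0" and pos: "\<And>x. x \<in> ball 0 2 - {0} \<Longrightarrow> u x > 0"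
    and u: "continuous_on (ball 0 2 - {0}) u"
    and \<omega>: "continuous_on (ball 0 2) \<omega>" "\<And>x. x \<in> ball 0 2 - {0} \<Longrightarrow> \<omega> x > 0"
    and K: "K > 0" "\<And>x. x \<in> ball 0 (1/4) - {0} \<Longrightarrow> u x powr - a \<le> K * \<omega> x"
  shows "0 < (INF x \<in> ball 0 1 - {0}. ereal (\<omega> x powr (1 / a) * u x))"
proof -
  define g where "g x = \<omega> x powr (1 / a) * u x" for x
  define A where "A = cball 0 1 - ball (0 :: real^'n) (1/4)"
  have A2: "A \<subseteq> ball 0 2 - {0}" by (auto simp: A_def)
  have gpos: "g x > 0" if "x \<in> ball 0 2 - {0}" for x
    using pos[OF that] \<omega>(2)[OF that] by (simp add: g_def)
  have "axis undefined 1 \<in> A" by (simp add: A_def)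
  then have "A \<noteq> {}" by blast
  moreover have "compact A" by (simp add: A_def compact_diff)
  moreover have "continuous_on A g"
    unfolding g_def
  proof (intro continuous_on_mult continuous_on_powr continuous_on_const ballI)
    show "continuous_on A \<omega>" "continuous_on A u"
      using A2 by (auto intro: continuous_on_subset[OF \<omega>(1)] continuous_on_subset[OF u])
    fix x assume "x \<in> A"
    then have "x \<in> ball 0 2 - {0}" using A2 by blast
    then show "\<omega> x \<noteq> 0" using \<omega>(2)[of x] by simp
  qed
  ultimately obtain z where z: "z \<in> A" "\<And>x. x \<in> A \<Longrightarrow> g z \<le> g x"
    using continuous_attains_inf[of A g] by blast
  define \<gamma> where "\<gamma> = min (g z) (K powr - (1 / a))"
  have "z \<in> ball 0 2 - {0}" using z(1) A2 by blast
  then have \<gamma>: "0 < ereal \<gamma>" using gpos[of z] K(1) by (simp add: \<gamma>_def)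
  have "\<gamma> \<le> g x" if x: "x \<in> ball 0 1 - {0}" for x
  proof (cases "x \<in> A")
    case True
    then show ?thesis using z(2)[OF True] by (simp add: \<gamma>_def)
  next
    case False
    with x have x4: "x \<in> ball 0 (1/4) - {0}" by (auto simp: A_def)
    have ux: "u x > 0" and \<omega>x: "\<omega> x > 0" using pos \<omega>(2) x by auto
    have "(K * \<omega> x) powr - (1 / a) \<le> (u x powr - a) powr - (1 / a)"
      using K(2)[OF x4] ux a by (intro powr_mono2') auto
    also have "\<dots> = u x" using ux a by (simp add: powr_powr)
    finally have "\<omega> x powr (1 / a) * (K * \<omega> x) powr - (1 / a) \<le> g x"
      unfolding g_def by (intro mult_left_mono) auto
    moreover have "\<omega> x powr (1 / a) * (K * \<omega> x) powr - (1 / a) = K powr - (1 / a)"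
    proof -
      have "(K * \<omega> x) powr - (1 / a) = K powr - (1 / a) * \<omega> x powr - (1 / a)"
        by (rule powr_mult)
      moreover have "\<omega> x powr (1 / a) * \<omega> x powr - (1 / a) = 1"
        using \<omega>x by (simp flip: powr_add)
      ultimately show ?thesis by simp
    qed
    ultimately show ?thesis by (simp add: \<gamma>_def)
  qed
  then have "ereal \<gamma> \<le> (INF x \<in> ball 0 1 - {0}. ereal (g x))" by (intro INF_greatest) simp
  then show ?thesis using less_le_trans[OF \<gamma>] unfolding g_def by blast
qed

section \<open>The behaviour of the limit at the puncture\<close>

theorem corollary1p3:
  fixes \<eta> :: "real^'n \<Rightarrow> real"
  assumes n_ge_3: "CARD('n) \<ge> 3"
    and eta_C2: "C2_on (ball 0 2 - {0}) \<eta>"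
    and eta_C0: "continuous_on (ball 0 2) \<eta>"
    and eta_0: "\<eta> 0 = 0"
    and eta_pos: "\<forall>x \<in> ball 0 2 - {0}. \<eta> x > 0"
  shows "\<exists>C>0. \<forall>(U :: (real^'n^'n) set) (u :: real^'n \<Rightarrow> real).
    openin (top_of_set sym_mats) U \<and>
    (\<forall>M\<in>U. \<forall>N\<in>pd_mats. M + N \<in> U) \<and>
    (\<forall>M\<in>U. \<forall>a>0. a *\<^sub>R M \<in> U) \<and>
    (\<forall>x \<in> ball 0 2 - {0}. hess \<eta> x \<notin> U) \<and>
    continuous_on (ball 0 2 - {0}) u \<and>
    (\<forall>x \<in> ball 0 2 - {0}. u x > 0) \<and>
    (\<exists>ui :: nat \<Rightarrow> real^'n \<Rightarrow> real.
       (\<forall>i. C2_on (ball 0 2 - {0}) (ui i)) \<and>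
       (\<forall>i. \<forall>x \<in> ball 0 2 - {0}.
          ui i x > 0 \<and> laplacian (ui i) x \<le> 0 \<and> conf_mat (ui i) x \<in> closure U) \<and>
       (\<forall>K. compact K \<and> K \<subseteq> ball 0 2 - {0} \<longrightarrow> uniform_limit K ui u sequentially))
    \<longrightarrow>
    (let n = real CARD('n);
         \<xi> = (\<lambda>x. u x powr (- (2 / (n - 2))))
     in
       (\<exists>\<xi>' :: real^'n \<Rightarrow> real.
          continuous_on (ball 0 1) \<xi>' \<and>
          (\<forall>x \<in> ball 0 1 - {0}. \<xi>' x = \<xi> x) \<and>
          (\<forall>x \<in> ball 0 (1/4). \<forall>y \<in> ball 0 (1/4).
             \<bar>\<xi>' x - \<xi>' y\<bar>
               \<le> C * min_on (sphere 0 1) u powr (- (2 / (n - 2))) * (\<eta> (x - y) + \<eta> (y - x)))) \<and>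
       (SUP x \<in> ball 0 1 - {0}. ereal (\<xi> x)) \<le> ereal (max_on (sphere 0 1) \<xi>) \<and>
       max_on (sphere 0 1) \<xi> = min_on (sphere 0 1) u powr (- (2 / (n - 2))) \<and>
       ((0 < (INF x \<in> ball 0 1 - {0}. ereal (u x)) \<and>
         (INF x \<in> ball 0 1 - {0}. ereal (u x)) \<le> (SUP x \<in> ball 0 1 - {0}. ereal (u x)) \<and>
         (SUP x \<in> ball 0 1 - {0}. ereal (u x)) < \<infinity> \<and>
         (\<exists>v :: real^'n \<Rightarrow> real.
            continuous_on (ball 0 1) v \<and> (\<forall>x \<in> ball 0 1 - {0}. v x = u x))) \<or>
        0 < (INF x \<in> ball 0 1 - {0}.
               ereal ((\<eta> x + \<eta> (- x)) powr ((n - 2) / 2) * u x))))"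
proof -
  \<comment> \<open>the differences \<open>x - y\<close> with \<open>|x| = 1\<close> and \<open>|y| < 1/4\<close> lie in this annulus; the minimum
    \<open>m\<close> of \<open>\<eta>\<close> over it gives the constant \<open>1 / m\<close>, which depends on \<open>\<eta>\<close> alone\<close>
  define A where "A = cball 0 (5/4) - ball (0 :: real^'n) (3/4)"
  have "axis undefined 1 \<in> A" by (simp add: A_def)
  then have "A \<noteq> {}" by blast
  moreover have "compact A" by (simp add: A_def compact_diff)
  moreover have A2: "A \<subseteq> ball 0 2 - {0}" by (auto simp: A_def)
  then have "continuous_on A \<eta>" by (intro continuous_on_subset[OF eta_C0]) auto
  ultimately obtain z0 where z0: "z0 \<in> A" "\<And>x. x \<in> A \<Longrightarrow> \<eta> z0 \<le> \<eta> x"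
    using continuous_attains_inf[of A \<eta>] by blast
  define m where "m = \<eta> z0"
  have "z0 \<in> ball 0 2 - {0}" using z0(1) A2 by blast
  then have m: "m > 0" using eta_pos by (simp add: m_def)
  have mA: "m \<le> \<eta> x" if "3/4 \<le> norm x" "norm x \<le> 5/4" for x
    using z0(2)[of x] that by (simp add: m_def A_def)
  have \<eta>pos: "\<And>x. x \<in> ball 0 2 - {0} \<Longrightarrow> \<eta> x > 0" using eta_pos by blast
  define \<omega> where "\<omega> x = \<eta> x + \<eta> (- x)" for x
  have "continuous_on (ball 0 2) (\<lambda>x. \<eta> (- x))"
    by (rule continuous_on_compose2[OF eta_C0]) (auto intro!: continuous_intros)
  then have \<omega>: "continuous_on (ball 0 2) \<omega>"
    unfolding \<omega>_def by (intro continuous_on_add eta_C0)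
  have \<omega>pos: "\<omega> x > 0" if "x \<in> ball 0 2 - {0}" for x
    using \<eta>pos[OF that] \<eta>pos[of "- x"] that by (simp add: \<omega>_def)
  define a where "a = 2 / (real CARD('n) - 2)"
  have a: "a > 0" and a_inv: "(real CARD('n) - 2) / 2 = 1 / a"
    using n_ge_3 by (simp_all add: a_def)
  show ?thesis
    unfolding Let_def a_def[symmetric] a_inv
  proof (rule exI[of _ "1 / m"], intro conjI[OF _ allI[OF allI[OF impI]]])
    show "1 / m > 0" using m by simp
    fix U :: "(real^'n^'n) set" and u :: "real^'n \<Rightarrow> real"
    assume hyp: "openin (top_of_set sym_mats) U \<and>
      (\<forall>M\<in>U. \<forall>N\<in>pd_mats. M + N \<in> U) \<and>
      (\<forall>M\<in>U. \<forall>a>0. a *\<^sub>R M \<in> U) \<and>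
      (\<forall>x \<in> ball 0 2 - {0}. hess \<eta> x \<notin> U) \<and>
      continuous_on (ball 0 2 - {0}) u \<and>
      (\<forall>x \<in> ball 0 2 - {0}. u x > 0) \<and>
      (\<exists>ui :: nat \<Rightarrow> real^'n \<Rightarrow> real.
         (\<forall>i. C2_on (ball 0 2 - {0}) (ui i)) \<and>
         (\<forall>i. \<forall>x \<in> ball 0 2 - {0}.
            ui i x > 0 \<and> laplacian (ui i) x \<le> 0 \<and> conf_mat (ui i) x \<in> closure U) \<and>
         (\<forall>K. compact K \<and> K \<subseteq> ball 0 2 - {0} \<longrightarrow> uniform_limit K ui u sequentially))"
    from hyp obtain ui :: "nat \<Rightarrow> real^'n \<Rightarrow> real" where
      hU: "openin (top_of_set sym_mats) U" and hadd: "\<forall>M\<in>U. \<forall>N\<in>pd_mats. M + N \<in> U"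
      and hcone: "\<forall>M\<in>U. \<forall>a>0. a *\<^sub>R M \<in> U"
      and h\<eta>: "\<forall>x \<in> ball 0 2 - {0}. hess \<eta> x \<notin> U"
      and u: "continuous_on (ball 0 2 - {0}) u" and hpos: "\<forall>x \<in> ball 0 2 - {0}. u x > 0"
      and C2: "\<forall>i. C2_on (ball 0 2 - {0}) (ui i)"
      and hui: "\<forall>i. \<forall>x \<in> ball 0 2 - {0}.
        ui i x > 0 \<and> laplacian (ui i) x \<le> 0 \<and> conf_mat (ui i) x \<in> closure U"
      and hlim: "\<forall>K. compact K \<and> K \<subseteq> ball 0 2 - {0} \<longrightarrow> uniform_limit K ui u sequentially"
      by (elim conjE exE) (rule that)
    have U: "U \<subseteq> sym_mats" using hU openin_imp_subset by blast
    have add: "\<And>M N. M \<in> U \<Longrightarrow> N \<in> pd_mats \<Longrightarrow> M + N \<in> U" using hadd by blast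
    have cone: "\<And>M k. M \<in> U \<Longrightarrow> k > 0 \<Longrightarrow> k *\<^sub>R M \<in> U" using hcone by blast
    have \<eta>U: "\<And>x. x \<in> ball 0 2 - {0} \<Longrightarrow> hess \<eta> x \<notin> U" using h\<eta> by blast
    have pos: "\<And>x. x \<in> ball 0 2 - {0} \<Longrightarrow> u x > 0" using hpos by blast
    have lim: "\<And>K. compact K \<Longrightarrow> K \<subseteq> ball 0 2 - {0} \<Longrightarrow> uniform_limit K ui u sequentially"
      using hlim by blast
    have ui: "\<And>i. positive_superharmonic (ui i)"
      "\<And>i x. x \<in> ball 0 2 - {0} \<Longrightarrow> conf_mat (ui i) x \<in> closure U"
      using C2 hui unfolding positive_superharmonic_def by blast+
    have "sphere (0 :: real^'n) 1 \<subseteq> ball 0 2 - {0}" by auto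
    then obtain z where z: "norm z = 1" "min_on (sphere 0 1) u = u z" "\<And>x. norm x = 1 \<Longrightarrow> u z \<le> u x"
      using min_on_attained[of "sphere 0 1" u] continuous_on_subset[OF u] by auto
    define \<mu> where "\<mu> = u z"
    have "z \<in> ball 0 2 - {0}" using z(1) by auto
    then have \<mu>: "\<mu> > 0" "\<And>x. norm x = 1 \<Longrightarrow> \<mu> \<le> u x" using pos z(3) by (simp_all add: \<mu>_def)
    note limit_estimates = locally_uniform_limit_estimates[OF n_ge_3 a_def U add cone
        eta_C2 eta_C0 eta_0 \<eta>pos \<eta>U m mA ui lim pos \<mu>]
    have u_ge: "\<mu> \<le> u x" if "x \<in> ball 0 1 - {0}" for x
      using limit_estimates(1) that by blast
    define \<xi> where "\<xi> x = u x powr - a" for x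
    define M where "M = \<mu> powr - a"
    define K where "K = 1 / m * M"
    have K: "K > 0" using m \<mu>(1) by (simp add: K_def M_def)
    have \<xi>le: "\<xi> x \<le> M" if "x \<in> ball 0 1 - {0}" for x
      unfolding \<xi>_def M_def using u_ge[OF that] \<mu>(1) a by (intro powr_mono2') auto
    have one_sided: "\<xi> x - \<xi> y \<le> K * \<eta> (x - y)"
      if "x \<in> ball 0 (1/4) - {0}" "y \<in> ball 0 (1/4) - {0}" for x y
    proof -
      have "x \<in> ball 0 1 - {0}" using that(1) by auto
      with limit_estimates(2) that(2) have "\<xi> x - \<xi> y \<le> M / m * \<eta> (x - y)"
        unfolding \<xi>_def M_def by blast
      then show ?thesis by (simp add: K_def)
    qed
    have \<eta>nonneg: "\<eta> x \<ge> 0" if "norm x < 2" for x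
      using \<eta>pos[of x] eta_0 that by (cases "x = 0") auto
    have osc: "\<bar>\<xi> x - \<xi> y\<bar> \<le> K * \<omega> (x - y)"
      if x: "x \<in> ball 0 (1/4) - {0}" and y: "y \<in> ball 0 (1/4) - {0}" for x y
    proof -
      have "norm (x - y) < 2" "norm (y - x) < 2"
        using norm_triangle_ineq4[of x y] norm_triangle_ineq4[of y x] x y by auto
      then have "0 \<le> K * \<eta> (x - y)" "0 \<le> K * \<eta> (y - x)" using K \<eta>nonneg by auto
      then show ?thesis
        using one_sided[OF x y] one_sided[OF y x] by (simp add: \<omega>_def distrib_left)
    qed
    have "continuous_on (ball 0 2 - {0}) \<xi>"
      unfolding \<xi>_def using pos by (intro continuous_on_powr u continuous_on_const) force
    moreover have "0 \<le> \<xi> x \<and> \<xi> x \<le> M" if "x \<in> ball 0 (1/4) - {0}" for x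
      using \<xi>le[of x] that by (auto simp: \<xi>_def)
    moreover have "continuous_on (ball 0 2) (\<lambda>x. K * \<omega> x)" by (intro continuous_intros \<omega>)
    moreover have "K * \<omega> 0 = 0" using eta_0 by (simp add: \<omega>_def)
    ultimately obtain L where L: "L \<ge> 0" "continuous_on (ball 0 2) (\<lambda>x. if x = 0 then L else \<xi> x)"
      and osc0: "\<And>x. x \<in> ball 0 (1/4) - {0} \<Longrightarrow> \<bar>\<xi> x - L\<bar> \<le> K * \<omega> x"
      using extension_by_modulus[of \<xi> M "\<lambda>x. K * \<omega> x"] osc by blast
    define \<xi>' where "\<xi>' x = (if x = 0 then L else \<xi> x)" for x
    have maxmin: "max_on (sphere 0 1) (\<lambda>x. u x powr - a) = min_on (sphere 0 1) u powr - a"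
      unfolding z(2) using z(1,3) \<mu> a
      by (intro max_on_eqI powr_mono2') (auto simp: \<mu>_def)
    have \<xi>'_cont: "continuous_on (ball 0 1) \<xi>'"
      unfolding \<xi>'_def by (rule continuous_on_subset[OF L(2)]) auto
    have \<xi>'_osc: "\<bar>\<xi>' x - \<xi>' y\<bar> \<le> K * (\<eta> (x - y) + \<eta> (y - x))"
      if x: "x \<in> ball 0 (1/4)" and y: "y \<in> ball 0 (1/4)" for x y
    proof -
      have sw: "\<eta> (x - y) + \<eta> (y - x) = \<omega> (x - y)" "\<omega> (- v) = \<omega> v" for v by (simp_all add: \<omega>_def)
      consider "x \<noteq> 0" "y \<noteq> 0" | "x \<noteq> 0" "y = 0" | "x = 0" "y \<noteq> 0" | "x = 0" "y = 0" by blast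
      then show ?thesis
      proof cases
        case 1
        then show ?thesis using osc[of x y] x y sw by (simp add: \<xi>'_def)
      next
        case 2
        then show ?thesis using osc0[of x] x sw by (simp add: \<xi>'_def)
      next
        case 3
        then show ?thesis using osc0[of y] y sw by (simp add: \<xi>'_def abs_minus_commute)
      next
        case 4
        then show ?thesis by (simp add: eta_0)
      qed
    qed
    have ext: "\<exists>\<xi>'. continuous_on (ball 0 1) \<xi>' \<and> (\<forall>x\<in>ball 0 1 - {0}. \<xi>' x = u x powr - a) \<and>
        (\<forall>x\<in>ball 0 (1 / 4). \<forall>y\<in>ball 0 (1 / 4). \<bar>\<xi>' x - \<xi>' y\<bar>
          \<le> 1 / m * min_on (sphere 0 1) u powr - a * (\<eta> (x - y) + \<eta> (y - x)))"
      using \<xi>'_cont \<xi>'_osc unfolding z(2) \<mu>_def[symmetric] M_def[symmetric] K_def[symmetric]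
      by (intro exI[of _ \<xi>']) (auto simp: \<xi>'_def \<xi>_def)
    have sup: "(SUP x\<in>ball 0 1 - {0}. ereal (u x powr - a))
        \<le> ereal (max_on (sphere 0 1) (\<lambda>x. u x powr - a))"
      unfolding maxmin z(2) using \<xi>le by (intro SUP_least) (simp add: \<xi>_def M_def \<mu>_def)
    have inf: "0 < (INF x\<in>ball 0 1 - {0}. ereal (u x))"
    proof (rule less_le_trans)
      show "0 < ereal \<mu>" using \<mu>(1) by simp
      show "ereal \<mu> \<le> (INF x\<in>ball 0 1 - {0}. ereal (u x))" using u_ge by (intro INF_greatest) simp
    qed
    have "(1/2 :: real) *\<^sub>R axis undefined 1 \<in> ball (0 :: real^'n) 1 - {0}" by simp
    then have infsup: "(INF x\<in>ball 0 1 - {0 :: real^'n}. ereal (u x)) \<le> (SUP x\<in>ball 0 1 - {0}. ereal (u x))"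
      by (intro INF_le_SUP) blast
    have alternative: "(SUP x\<in>ball 0 1 - {0}. ereal (u x)) < \<infinity> \<and>
          (\<exists>v. continuous_on (ball 0 1) v \<and> (\<forall>x\<in>ball 0 1 - {0}. v x = u x)) \<or>
        0 < (INF x\<in>ball 0 1 - {0}. ereal ((\<eta> x + \<eta> (- x)) powr (1 / a) * u x))"
    proof (cases "L > 0")
      case True
      then show ?thesis
        using bounded_continuous_extension[OF a pos L(2)[unfolded \<xi>_def]] by blast
    next
      case False
      then have "L = 0" using L(1) by simp
      then have "u x powr - a \<le> K * \<omega> x" if "x \<in> ball 0 (1/4) - {0}" for x
        using osc0[OF that] by (simp add: \<xi>_def)
      from barrier_blow_up_rate[OF a pos u \<omega> \<omega>pos K this] show ?thesis
        by (simp add: \<omega>_def)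
    qed
    show "(\<exists>\<xi>'. continuous_on (ball 0 1) \<xi>' \<and> (\<forall>x\<in>ball 0 1 - {0}. \<xi>' x = u x powr - a) \<and>
        (\<forall>x\<in>ball 0 (1 / 4). \<forall>y\<in>ball 0 (1 / 4). \<bar>\<xi>' x - \<xi>' y\<bar>
          \<le> 1 / m * min_on (sphere 0 1) u powr - a * (\<eta> (x - y) + \<eta> (y - x)))) \<and>
      (SUP x\<in>ball 0 1 - {0}. ereal (u x powr - a))
        \<le> ereal (max_on (sphere 0 1) (\<lambda>x. u x powr - a)) \<and>
      max_on (sphere 0 1) (\<lambda>x. u x powr - a) = min_on (sphere 0 1) u powr - a \<and>
      (0 < (INF x\<in>ball 0 1 - {0}. ereal (u x)) \<and>
       (INF x\<in>ball 0 1 - {0}. ereal (u x)) \<le> (SUP x\<in>ball 0 1 - {0}. ereal (u x)) \<and>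
       (SUP x\<in>ball 0 1 - {0}. ereal (u x)) < \<infinity> \<and>
       (\<exists>v. continuous_on (ball 0 1) v \<and> (\<forall>x\<in>ball 0 1 - {0}. v x = u x)) \<or>
       0 < (INF x\<in>ball 0 1 - {0}. ereal ((\<eta> x + \<eta> (- x)) powr (1 / a) * u x)))"
      using ext sup maxmin inf infsup alternative by blast
  qed
qed

end
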